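(* Let $L=p_k(x)\partial_x^k+\dots+p_1(x)\partial_x+p_0(x)$, with $p_k\ne0$, be a linear differential operator in $\mathbb{Q}[x]\langle\partial_x;\mathrm{Id},d/dx\rangle$. The evaluation of $\varphi(L)$ by Horner's rule \[\varphi(L)=(\dotsb(p_k(X)D+p_{k-1}(X))D+\dotsb)D+p_0(X),\] in which each sum and each product of fractions is computed by the two reduction rules (for sums and for products) given in the context, produces a fraction $Q^{-1}P$ that is irreducible.
   Context: Operators. In $\mathbb{Q}[x]\langle\partial_x;\mathrm{Id},d/dx\rangle$ one has $\partial_xx=x\partial_x+1$. $\mathbb{Q}(n)\langle S,S^{-1};S\rangle$ is the ring of Laurent polynomials in $S$ with coefficients in $\mathbb{Q}(n)$, with $S\,a(n)=a(n+1)\,S$. In it, least common left multiples (lclm) and greatest common left divisors (gcld) exist, up to units. Its skew field of fractions consists of the left fractions $Q^{-1}P$, $Q\neq0$; $Q^{-1}P$ is irreducible when $\operatorname{gcld}(P,Q)=1$ (i.e. is a unit). Morphism. $\varphi$ is the $\mathbb{Q}$-algebra morphism from $\mathbb{Q}[x]\langle\partial_x;\mathrm{Id},d/dx\rangle$ to this skew field with $\varphi(x)=X:=\frac12(S+S^{-1})$ and $\varphi(\partial_x)=D:=(S^{-1}-S)^{-1}(2n)$. Reduction rules. Sums: $Q_1^{-1}P_1+Q_2^{-1}P_2=\operatorname{lclm}(Q_1,Q_2)^{-1}(\tilde Q_1P_1+\tilde Q_2P_2)$, where $\tilde Q_1Q_1=\tilde Q_2Q_2=\operatorname{lclm}(Q_1,Q_2)$.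 Products: $Q_1^{-1}P_1\,Q_2^{-1}P_2=(\hat P_1Q_1)^{-1}(\hat Q_2P_2)$, where $\hat P_1P_1=\hat Q_2Q_2=\operatorname{lclm}(Q_2,P_1)$. Explicitly, the evaluation (Lewanowicz' algorithm) is: start with $P:=p_k(X)$, $Q:=1$; for $i$ from $k-1$ down to $0$, compute $\hat P,\hat U$ with $\operatorname{lclm}(S^{-1}-S,P)=\hat PP=\hat U(S^{-1}-S)$, then set $Q:=\hat PQ$ and $P:=\hat U\,2n+Qp_i(X)$ (with the new $Q$); the result is $(P,Q)$ with $\varphi(L)=Q^{-1}P$. *)

theory Defs
  imports "HOL-Computational_Algebra.Polynomial_Factorial"
begin

type_synonym ratfun = "rat poly fract"

lemma pcompose_shift_eq_0_iff: "pcompose p [:of_int k, 1:] = 0 \<longleftrightarrow> p = 0" for p :: "rat poly"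
  by (rule pcompose_eq_0_iff) simp

text \<open>\<open>shift k\<close> is the automorphism \<open>a(n) \<mapsto> a(n + k)\<close>.\<close>

definition shift :: "int \<Rightarrow> ratfun \<Rightarrow> ratfun" where
  "shift k q = (THE r. \<exists>a b. b \<noteq> 0 \<and> q = Fract a b \<and>
     r = Fract (pcompose a [:of_int k, 1:]) (pcompose b [:of_int k, 1:]))"

lemma shift_Fract:
  assumes "b \<noteq> 0"
  shows "shift k (Fract a b) = Fract (pcompose a [:of_int k, 1:]) (pcompose b [:of_int k, 1:])"
  unfolding shift_def
  by (rule the_equality)
    (use assms in \<open>auto simp: eq_fract pcompose_shift_eq_0_iff simp flip: pcompose_mult\<close>)

lemma shift_0 [simp]: "shift k 0 = 0"
  by (simp add: Zero_fract_def shift_Fract pcompose_1)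

lemma shift_1 [simp]: "shift k 1 = 1"
  by (simp add: One_fract_def shift_Fract pcompose_1)

lemma shift_add: "shift k (a + b) = shift k a + shift k b"
  by (cases a, cases b)
    (simp add: shift_Fract pcompose_shift_eq_0_iff pcompose_mult pcompose_add)

lemma shift_mult: "shift k (a * b) = shift k a * shift k b"
  by (cases a, cases b) (simp add: shift_Fract pcompose_mult)

lemma shift_sum: "shift k (sum f A) = (\<Sum>i\<in>A. shift k (f i))"
  by (induction A rule: infinite_finite_induct) (auto simp: shift_add)

lemma shift_by_0 [simp]: "shift 0 a = a"
  by (cases a) (simp add: shift_Fract)

lemma shift_shift: "shift j (shift k a) = shift (j + k) a"
proof (cases a)
  case (Fract p q)
  have "pcompose (pcompose r [:of_int k, 1:]) [:of_int j, 1:] = pcompose r [:of_int (j + k), 1:]"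
    for r :: "rat poly"
    by (simp flip: pcompose_assoc add: pcompose_pCons add_ac)
  with Fract show ?thesis
    by (simp add: shift_Fract pcompose_shift_eq_0_iff)
qed

lemma shift_eq_0_iff [simp]: "shift k a = 0 \<longleftrightarrow> a = 0"
  by (metis add.left_inverse shift_0 shift_by_0 shift_shift)

text \<open>\<open>f\<close> stands for the sum of \<open>scoeff f i * S ^ i\<close>, coefficients on the left; multiplication
  encodes \<open>S a(n) = a(n + 1) S\<close>.\<close>

typedef skew_laurent = "{f :: int \<Rightarrow> ratfun. finite {i. f i \<noteq> 0}}"
  morphisms scoeff Abs_skew_laurent
  by (rule exI[of _ "\<lambda>_. 0"]) simp

lemma finite_scoeff [simp]: "finite {i. scoeff f i \<noteq> 0}"
  using scoeff[of f] by simp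

lemma skew_laurent_eqI: "(\<And>i. scoeff f i = scoeff g i) \<Longrightarrow> f = g"
  by (auto simp: scoeff_inject[symmetric])

definition smonom :: "ratfun \<Rightarrow> int \<Rightarrow> skew_laurent" where
  "smonom a k = Abs_skew_laurent (\<lambda>i. if i = k then a else 0)"

lemma scoeff_smonom: "scoeff (smonom a k) i = (if i = k then a else 0)"
  unfolding smonom_def by (subst Abs_skew_laurent_inverse) (auto intro: finite_subset[of _ "{k}"])

instantiation skew_laurent :: ring_1
begin

definition zero_skew_laurent :: skew_laurent where
  "0 = Abs_skew_laurent (\<lambda>_. 0)"

definition one_skew_laurent :: skew_laurent where
  "1 = smonom 1 0"

definition plus_skew_laurent :: "skew_laurent \<Rightarrow> skew_laurent \<Rightarrow> skew_laurent" where
  "f + g = Abs_skew_laurent (\<lambda>i. scoeff f i + scoeff g i)"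

definition uminus_skew_laurent :: "skew_laurent \<Rightarrow> skew_laurent" where
  "- f = Abs_skew_laurent (\<lambda>i. - scoeff f i)"

definition minus_skew_laurent :: "skew_laurent \<Rightarrow> skew_laurent \<Rightarrow> skew_laurent" where
  "f - g = Abs_skew_laurent (\<lambda>i. scoeff f i - scoeff g i)"

definition times_skew_laurent :: "skew_laurent \<Rightarrow> skew_laurent \<Rightarrow> skew_laurent" where
  "f * g = Abs_skew_laurent (\<lambda>k. \<Sum>i | scoeff f i \<noteq> 0. scoeff f i * shift i (scoeff g (k - i)))"

lemma scoeff_zero: "scoeff 0 i = 0"
  unfolding zero_skew_laurent_def by (subst Abs_skew_laurent_inverse) auto

lemma scoeff_plus: "scoeff (f + g) i = scoeff f i + scoeff g i"
  unfolding plus_skew_laurent_def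
  by (subst Abs_skew_laurent_inverse)
    (auto intro: finite_subset[of _ "{i. scoeff f i \<noteq> 0} \<union> {i. scoeff g i \<noteq> 0}"])

lemma scoeff_uminus: "scoeff (- f) i = - scoeff f i"
  unfolding uminus_skew_laurent_def by (subst Abs_skew_laurent_inverse) auto

lemma scoeff_minus: "scoeff (f - g) i = scoeff f i - scoeff g i"
  unfolding minus_skew_laurent_def
  by (subst Abs_skew_laurent_inverse)
    (auto intro: finite_subset[of _ "{i. scoeff f i \<noteq> 0} \<union> {i. scoeff g i \<noteq> 0}"])

lemma times_support:
  "{k. (\<Sum>i | scoeff f i \<noteq> 0. scoeff f i * shift i (scoeff g (k - i))) \<noteq> 0}
    \<subseteq> (\<lambda>(i, j). i + j) ` ({i. scoeff f i \<noteq> 0} \<times> {j. scoeff g j \<noteq> 0})"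
proof
  fix k assume "k \<in> {k. (\<Sum>i | scoeff f i \<noteq> 0. scoeff f i * shift i (scoeff g (k - i))) \<noteq> 0}"
  then obtain i where "scoeff f i \<noteq> 0" "scoeff f i * shift i (scoeff g (k - i)) \<noteq> 0"
    using sum.not_neutral_contains_not_neutral by blast
  thus "k \<in> (\<lambda>(i, j). i + j) ` ({i. scoeff f i \<noteq> 0} \<times> {j. scoeff g j \<noteq> 0})"
    by (intro image_eqI[of _ _ "(i, k - i)"]) auto
qed

lemma scoeff_times:
  "scoeff (f * g) k = (\<Sum>i | scoeff f i \<noteq> 0. scoeff f i * shift i (scoeff g (k - i)))"
  unfolding times_skew_laurent_def
  by (subst Abs_skew_laurent_inverse) (auto intro: finite_subset[OF times_support])

lemma scoeff_times_superset:
  assumes "finite A" "{i. scoeff f i \<noteq> 0} \<subseteq> A"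
  shows "scoeff (f * g) k = (\<Sum>i\<in>A. scoeff f i * shift i (scoeff g (k - i)))"
  unfolding scoeff_times using assms
  by (intro sum.mono_neutral_left) auto

lemma skew_laurent_mult_assoc: "(f * g) * h = f * (g * h)" for f g h :: skew_laurent
proof (rule skew_laurent_eqI)
  fix k
  let ?F = "{i. scoeff f i \<noteq> 0}" and ?G = "{i. scoeff g i \<noteq> 0}"
  let ?A = "(\<lambda>(i, j). i + j) ` (?F \<times> ?G)"
  have A: "{i. scoeff (f * g) i \<noteq> 0} \<subseteq> ?A"
    unfolding scoeff_times by (rule times_support)
  have "scoeff ((f * g) * h) k = (\<Sum>i\<in>?A. scoeff (f * g) i * shift i (scoeff h (k - i)))"
    by (rule scoeff_times_superset) (use A in auto)
  also have "\<dots> = (\<Sum>i\<in>?A. \<Sum>j\<in>?F. scoeff f j * shift j (scoeff g (i - j)) * shift i (scoeff h (k - i)))"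
    by (simp add: scoeff_times sum_distrib_right)
  also have "\<dots> = (\<Sum>j\<in>?F. \<Sum>i\<in>?A. scoeff f j * shift j (scoeff g (i - j)) * shift i (scoeff h (k - i)))"
    by (rule sum.swap)
  also have "\<dots> = (\<Sum>j\<in>?F. scoeff f j * shift j (scoeff (g * h) (k - j)))"
  proof (rule sum.cong[OF refl])
    fix j assume j: "j \<in> ?F"
    have "(\<Sum>i\<in>?A. scoeff f j * shift j (scoeff g (i - j)) * shift i (scoeff h (k - i)))
        = (\<Sum>i\<in>(\<lambda>l. j + l) ` ?G. scoeff f j * shift j (scoeff g (i - j)) * shift i (scoeff h (k - i)))"
    proof (rule sum.mono_neutral_right)
      show "finite ?A" by simp
      show "(\<lambda>l. j + l) ` ?G \<subseteq> ?A" using j by force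
      show "\<forall>i\<in>?A - (\<lambda>l. j + l) ` ?G. scoeff f j * shift j (scoeff g (i - j)) * shift i (scoeff h (k - i)) = 0"
      proof
        fix i assume "i \<in> ?A - (\<lambda>l. j + l) ` ?G"
        hence "i - j \<notin> ?G" using image_eqI[of i "\<lambda>l. j + l" "i - j" ?G] by auto
        thus "scoeff f j * shift j (scoeff g (i - j)) * shift i (scoeff h (k - i)) = 0" by simp
      qed
    qed
    also have "\<dots> = (\<Sum>l\<in>?G. scoeff f j * shift j (scoeff g l) * shift (j + l) (scoeff h (k - j - l)))"
      by (subst sum.reindex) (auto simp: algebra_simps)
    also have "\<dots> = scoeff f j * shift j (scoeff (g * h) (k - j))"
      by (simp add: scoeff_times shift_sum shift_mult shift_shift sum_distrib_left mult.assoc)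
    finally show "(\<Sum>i\<in>?A. scoeff f j * shift j (scoeff g (i - j)) * shift i (scoeff h (k - i)))
        = scoeff f j * shift j (scoeff (g * h) (k - j))" .
  qed
  also have "\<dots> = scoeff (f * (g * h)) k"
    by (simp add: scoeff_times)
  finally show "scoeff ((f * g) * h) k = scoeff (f * (g * h)) k" .
qed

instance
proof
  fix f g h :: skew_laurent
  show "f + g + h = f + (g + h)" "f + g = g + f" "0 + f = f" "- f + f = 0" "f - g = f + - g"
    by (rule skew_laurent_eqI; simp add: scoeff_zero scoeff_plus scoeff_uminus scoeff_minus add_ac)+
  show "f * g * h = f * (g * h)" by (rule skew_laurent_mult_assoc)
  show "(f + g) * h = f * h + g * h"
  proof (rule skew_laurent_eqI)
    fix k
    let ?A = "{i. scoeff f i \<noteq> 0} \<union> {i. scoeff g i \<noteq> 0}"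
    have "scoeff ((f + g) * h) k = (\<Sum>i\<in>?A. scoeff (f + g) i * shift i (scoeff h (k - i)))"
         "scoeff (f * h) k = (\<Sum>i\<in>?A. scoeff f i * shift i (scoeff h (k - i)))"
         "scoeff (g * h) k = (\<Sum>i\<in>?A. scoeff g i * shift i (scoeff h (k - i)))"
      by (rule scoeff_times_superset; auto simp: scoeff_plus)+
    thus "scoeff ((f + g) * h) k = scoeff (f * h + g * h) k"
      by (simp add: scoeff_plus sum.distrib ring_distribs)
  qed
  show "f * (g + h) = f * g + f * h"
    by (rule skew_laurent_eqI)
      (simp add: scoeff_times scoeff_plus shift_add ring_distribs sum.distrib)
  show "1 * f = f"
  proof (rule skew_laurent_eqI)
    fix k
    have "scoeff (1 * f) k = (\<Sum>i\<in>{0}. scoeff 1 i * shift i (scoeff f (k - i)))"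
      by (rule scoeff_times_superset) (auto simp: one_skew_laurent_def scoeff_smonom split: if_splits)
    thus "scoeff (1 * f) k = scoeff f k" by (simp add: one_skew_laurent_def scoeff_smonom)
  qed
  show "f * 1 = f"
  proof (rule skew_laurent_eqI)
    fix k
    have "scoeff (f * 1) k = (\<Sum>i | scoeff f i \<noteq> 0. scoeff f i * (if i = k then 1 else 0))"
      unfolding scoeff_times
      by (rule sum.cong) (auto simp: one_skew_laurent_def scoeff_smonom)
    also have "\<dots> = scoeff f k"
      by (simp add: if_distrib[of "\<lambda>x. _ * x"] sum.delta cong: if_cong)
    finally show "scoeff (f * 1) k = scoeff f k" .
  qed
  show "(0::skew_laurent) \<noteq> 1"
    by (auto simp: one_skew_laurent_def scoeff_inject[symmetric] scoeff_zero
        scoeff_smonom fun_eq_iff)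
qed

end

lemmas scoeff_simps = scoeff_zero scoeff_plus scoeff_uminus
  scoeff_minus scoeff_smonom

lemma scoeff_smonom_times: "scoeff (smonom a j * f) k = a * shift j (scoeff f (k - j))"
proof -
  have "scoeff (smonom a j * f) k = (\<Sum>i\<in>{j}. scoeff (smonom a j) i * shift i (scoeff f (k - i)))"
    by (rule scoeff_times_superset) (auto simp: scoeff_smonom split: if_splits)
  thus ?thesis by (simp add: scoeff_smonom)
qed

lemma smonom_times_smonom: "smonom a i * smonom b j = smonom (a * shift i b) (i + j)"
  by (rule skew_laurent_eqI) (auto simp: scoeff_smonom_times scoeff_smonom)

lemma smonom_add: "smonom a i + smonom b i = smonom (a + b) i"
  by (rule skew_laurent_eqI) (auto simp: scoeff_simps)

lemma smonom_diff: "smonom a i - smonom b i = smonom (a - b) i"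
  by (rule skew_laurent_eqI) (auto simp: scoeff_simps)

definition top_exp :: "skew_laurent \<Rightarrow> int" where "top_exp f = Max {i. scoeff f i \<noteq> 0}"
definition bot_exp :: "skew_laurent \<Rightarrow> int" where "bot_exp f = Min {i. scoeff f i \<noteq> 0}"

lemma supp_nonempty: "f \<noteq> 0 \<Longrightarrow> {i. scoeff f i \<noteq> 0} \<noteq> {}"
  using skew_laurent_eqI[of f 0] by (auto simp: scoeff_zero)

lemma scoeff_top_exp: "f \<noteq> 0 \<Longrightarrow> scoeff f (top_exp f) \<noteq> 0"
  using Max_in[OF finite_scoeff supp_nonempty, of f] by (auto simp: top_exp_def)

lemma scoeff_bot_exp: "f \<noteq> 0 \<Longrightarrow> scoeff f (bot_exp f) \<noteq> 0"
  using Min_in[OF finite_scoeff supp_nonempty, of f] by (auto simp: bot_exp_def)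

lemma le_top_exp: "scoeff f i \<noteq> 0 \<Longrightarrow> i \<le> top_exp f"
  by (simp add: top_exp_def)

lemma bot_exp_le: "scoeff f i \<noteq> 0 \<Longrightarrow> bot_exp f \<le> i"
  by (simp add: bot_exp_def)

lemma scoeff_times_top_exp: "f \<noteq> 0 \<Longrightarrow>
  scoeff (f * g) (top_exp f + top_exp g) = scoeff f (top_exp f) * shift (top_exp f) (scoeff g (top_exp g))"
proof -
  assume f: "f \<noteq> 0"
  have "scoeff (f * g) (top_exp f + top_exp g)
      = (\<Sum>i\<in>{top_exp f}. scoeff f i * shift i (scoeff g (top_exp f + top_exp g - i)))"
    unfolding scoeff_times
  proof (rule sum.mono_neutral_right)
    show "\<forall>i\<in>{i. scoeff f i \<noteq> 0} - {top_exp f}. scoeff f i * shift i (scoeff g (top_exp f + top_exp g - i)) = 0"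
    proof
      fix i assume i: "i \<in> {i. scoeff f i \<noteq> 0} - {top_exp f}"
      hence "i < top_exp f" using le_top_exp[of f i] by force
      hence "scoeff g (top_exp f + top_exp g - i) = 0" using le_top_exp[of g] by force
      thus "scoeff f i * shift i (scoeff g (top_exp f + top_exp g - i)) = 0" by simp
    qed
  qed (use f scoeff_top_exp in auto)
  thus ?thesis by simp
qed

instance skew_laurent :: ring_1_no_zero_divisors
proof
  fix f g :: skew_laurent
  assume "f \<noteq> 0" "g \<noteq> 0"
  hence "scoeff (f * g) (top_exp f + top_exp g) \<noteq> 0"
    by (simp add: scoeff_times_top_exp scoeff_top_exp)
  thus "f * g \<noteq> 0" by (auto simp: scoeff_zero)
qed

class left_ore_domain = ring_1_no_zero_divisors +
  assumes left_ore: "s \<noteq> 0 \<Longrightarrow> \<exists>u v. u \<noteq> 0 \<and> u * a = v * s"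

definition sl_width :: "skew_laurent \<Rightarrow> nat" where
  "sl_width f = (if f = 0 then 0 else Suc (nat (top_exp f - bot_exp f)))"

lemma sl_width_le:
  assumes "\<And>i. scoeff f i \<noteq> 0 \<Longrightarrow> a \<le> i \<and> i < a + int n"
  shows "sl_width f \<le> n"
proof (cases "f = 0")
  case False
  from assms[OF scoeff_bot_exp[OF False]] assms[OF scoeff_top_exp[OF False]] bot_exp_le[OF scoeff_top_exp[OF False]] False show ?thesis
    by (simp add: sl_width_def)
qed (simp add: sl_width_def)

lemma skew_laurent_division:
  assumes b: "b \<noteq> 0"
  shows "\<exists>q. sl_width (a - q * b) < sl_width b"
proof (induction "sl_width a" arbitrary: a rule: less_induct)
  case less
  show ?case
  proof (cases "sl_width a < sl_width b")
    case True
    thus ?thesis by (intro exI[of _ 0]) simp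
  next
    case False
    with b have a: "a \<noteq> 0" by (auto simp: sl_width_def)
    have le: "top_exp b - bot_exp b \<le> top_exp a - bot_exp a"
      using False a b bot_exp_le[OF scoeff_top_exp[OF a]] bot_exp_le[OF scoeff_top_exp[OF b]]
      unfolding sl_width_def by auto
    define d where "d = top_exp a - top_exp b"
    define q where "q = smonom (scoeff a (top_exp a) / shift d (scoeff b (top_exp b))) d"
    have "sl_width (a - q * b) \<le> nat (top_exp a - bot_exp a)"
    proof (rule sl_width_le[of _ "bot_exp a"])
      fix i assume i: "scoeff (a - q * b) i \<noteq> 0"
      have eq: "scoeff (a - q * b) i =
        scoeff a i - scoeff a (top_exp a) / shift d (scoeff b (top_exp b)) * shift d (scoeff b (i - d))"
        by (simp add: q_def scoeff_simps scoeff_smonom_times)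
      have "i \<noteq> top_exp a"
        using i scoeff_top_exp[OF b] unfolding eq by (auto simp: d_def)
      moreover have "scoeff a i \<noteq> 0 \<or> scoeff b (i - d) \<noteq> 0"
        using i unfolding eq by auto
      ultimately show "bot_exp a \<le> i \<and> i < bot_exp a + int (nat (top_exp a - bot_exp a))"
        using le_top_exp[of a i] bot_exp_le[of a i] le_top_exp[of b "i - d"] bot_exp_le[of b "i - d"] le
          bot_exp_le[OF scoeff_top_exp[OF a]] unfolding d_def by linarith
    qed
    also have "\<dots> < sl_width a" using a by (simp add: sl_width_def)
    finally obtain q' where "sl_width (a - q * b - q' * b) < sl_width b"
      using less by blast
    moreover have "a - q * b - q' * b = a - (q + q') * b" by (simp add: algebra_simps)
    ultimately show ?thesis by metis
  qed
qed

instance skew_laurent :: left_ore_domain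
proof
  fix s a :: skew_laurent
  assume "s \<noteq> 0"
  thus "\<exists>u v. u \<noteq> 0 \<and> u * a = v * s"
  proof (induction "sl_width s" arbitrary: s a rule: less_induct)
    case less
    obtain q where q: "sl_width (a - q * s) < sl_width s"
      using skew_laurent_division[OF less.prems] by blast
    show ?case
    proof (cases "a - q * s = 0")
      case True
      thus ?thesis by (intro exI[of _ 1] exI[of _ q]) simp
    next
      case False
      from less.hyps[OF q False, of s] obtain u v where uv: "u \<noteq> 0" "u * s = v * (a - q * s)" by blast
      have "v \<noteq> 0" using uv less.prems by auto
      moreover have "v * a = (u + v * q) * s" using uv(2) by (simp add: algebra_simps)
      ultimately show ?thesis by blast
    qed
  qed
qed

text \<open>A pair \<open>(s, a)\<close> stands for the left fraction \<open>s\<^sup>-\<^sup>1 a\<close>, denominator first;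
  \<open>Lfrac 0 a\<close> is \<open>0\<close> by convention.\<close>

definition fracrel :: "'a::left_ore_domain \<times> 'a \<Rightarrow> 'a \<times> 'a \<Rightarrow> bool" where
  "fracrel = (\<lambda>(s, a) (t, b). s \<noteq> 0 \<and> t \<noteq> 0 \<and> (\<exists>u v. u \<noteq> 0 \<and> u * s = v * t \<and> u * a = v * b))"

lemma left_ore2:
  fixes s t :: "'a::left_ore_domain"
  assumes "s \<noteq> 0" "t \<noteq> 0"
  obtains u v where "u \<noteq> 0" "v \<noteq> 0" "u * s = v * t"
  using left_ore[OF assms(2), of s] assms by (metis mult_eq_0_iff)

lemma fracrel_sym: "fracrel x y \<Longrightarrow> fracrel y x"
  unfolding fracrel_def by (auto split: prod.splits) (metis mult_eq_0_iff)

lemma fracrel_trans: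
  assumes "fracrel x y" "fracrel y z"
  shows "fracrel x z"
proof -
  obtain s a t b r c where [simp]: "x = (s, a)" "y = (t, b)" "z = (r, c)" by (metis surj_pair)
  from assms obtain u v u' v' where nz: "s \<noteq> 0" "t \<noteq> 0" "r \<noteq> 0" and uv: "u \<noteq> 0" "u * s = v * t" "u * a = v * b"
    and uv': "u' \<noteq> 0" "u' * t = v' * r" "u' * b = v' * c"
    by (auto simp: fracrel_def)
  have "v \<noteq> 0" using uv nz by auto
  then obtain w w' where w: "w \<noteq> 0" "w' \<noteq> 0" "w * v = w' * u'" using left_ore2 uv'(1) by metis
  have "(w * u) * s = (w' * v') * r" "(w * u) * a = (w' * v') * c"
    using uv uv' w by (metis mult.assoc)+
  moreover have "w * u \<noteq> 0" using w(1) uv(1) by simp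
  ultimately have "\<exists>u v. u \<noteq> 0 \<and> u * s = v * r \<and> u * a = v * c" by blast
  thus ?thesis using nz unfolding fracrel_def by simp
qed

quotient_type (overloaded) 'a lfrac = "'a::left_ore_domain \<times> 'a" / partial: fracrel
proof (rule part_equivpI)
  show "\<exists>x. fracrel x x" by (rule exI[of _ "(1, 0)"]) (auto simp: fracrel_def intro!: exI[of _ 1])
qed (auto simp: symp_def transp_def intro: fracrel_sym fracrel_trans)

lift_definition Lfrac :: "'a::left_ore_domain \<Rightarrow> 'a \<Rightarrow> 'a lfrac"
  is "\<lambda>s a. if s = 0 then (1, 0) else (s, a)"
  by (auto simp: fracrel_def intro!: exI[of _ 1])

lemma Lfrac_cases: obtains s a where "f = Lfrac s a" "s \<noteq> 0"
  by transfer (auto simp: fracrel_def split: if_splits)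

lemma Lfrac_eq_iff:
  assumes "s \<noteq> 0" "t \<noteq> 0"
  shows "Lfrac s a = Lfrac t b \<longleftrightarrow> (\<exists>u v. u \<noteq> 0 \<and> u * s = v * t \<and> u * a = v * b)"
  using assms by transfer (auto simp: fracrel_def)

lemma Lfrac_expand: "u \<noteq> 0 \<Longrightarrow> s \<noteq> 0 \<Longrightarrow> Lfrac (u * s) (u * a) = Lfrac s a"
  by (subst Lfrac_eq_iff) (simp, simp, rule exI[of _ 1], rule exI[of _ u], simp)

lemma Lfrac_same_denom [simp]:
  assumes "s \<noteq> 0"
  shows "Lfrac s a = Lfrac s b \<longleftrightarrow> a = b"
  using assms by (auto simp: Lfrac_eq_iff intro: exI[of _ 1])

definition lf_acts :: "'a::left_ore_domain lfrac \<Rightarrow> 'a \<Rightarrow> 'a \<Rightarrow> bool" where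
  "lf_acts f x y \<longleftrightarrow> (\<exists>u. u \<noteq> 0 \<and> (\<exists>s a v. s \<noteq> 0 \<and> f = Lfrac s a \<and> u * x = v * s \<and> u * y = v * a))"

text \<open>\<^term>\<open>lf_acts f x y\<close> says that \<open>x f = y\<close> in the fraction field.\<close>

lemma lf_acts_Lfrac: "s \<noteq> 0 \<Longrightarrow> lf_acts (Lfrac s a) x y \<longleftrightarrow> (\<exists>u v. u \<noteq> 0 \<and> u * x = v * s \<and> u * y = v * a)"
proof
  assume s: "s \<noteq> 0"
  assume "lf_acts (Lfrac s a) x y"
  then obtain u t b v where u: "u \<noteq> 0" "t \<noteq> 0" "Lfrac s a = Lfrac t b" "u * x = v * t" "u * y = v * b"
    unfolding lf_acts_def by blast
  from u(3) s u(2) obtain p q where pq: "p \<noteq> 0" "p * s = q * t" "p * a = q * b"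
    by (auto simp: Lfrac_eq_iff)
  have "q \<noteq> 0" using pq s by auto
  then obtain w w' where w: "w \<noteq> 0" "w * v = w' * q"
    using left_ore by metis
  have "(w * u) * x = (w' * p) * s" "(w * u) * y = (w' * p) * a"
    using u pq w by (metis mult.assoc)+
  thus "\<exists>u v. u \<noteq> 0 \<and> u * x = v * s \<and> u * y = v * a"
    using w u(1) by (metis mult_eq_0_iff)
qed (auto simp: lf_acts_def)

lemma lf_acts_self: "s \<noteq> 0 \<Longrightarrow> lf_acts (Lfrac s a) s a"
  by (subst lf_acts_Lfrac) (auto intro!: exI[of _ 1])

lemma lf_acts_iff: "x \<noteq> 0 \<Longrightarrow> lf_acts f x y \<longleftrightarrow> f = Lfrac x y"
proof
  assume x: "x \<noteq> 0" and f: "lf_acts f x y"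
  obtain s a where s: "f = Lfrac s a" "s \<noteq> 0" by (rule Lfrac_cases)
  with f obtain u v where "u \<noteq> 0" "u * x = v * s" "u * y = v * a" by (auto simp: lf_acts_Lfrac)
  hence "Lfrac x y = Lfrac s a" using s x by (auto simp: Lfrac_eq_iff)
  thus "f = Lfrac x y" using s by simp
qed (auto intro: lf_acts_self)

lemma lf_acts_scale: "lf_acts f x y \<Longrightarrow> lf_acts f (w * x) (w * y)"
proof -
  assume f: "lf_acts f x y"
  obtain s a where s: "f = Lfrac s a" "s \<noteq> 0" by (rule Lfrac_cases)
  with f obtain u v where uv: "u \<noteq> 0" "u * x = v * s" "u * y = v * a" by (auto simp: lf_acts_Lfrac)
  obtain p q where pq: "p \<noteq> 0" "p * w = q * u" using left_ore[OF uv(1), of w] by auto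
  have "p * (w * x) = (q * v) * s" "p * (w * y) = (q * v) * a"
    using pq uv by (metis mult.assoc)+
  with s pq show ?thesis by (auto simp: lf_acts_Lfrac)
qed

lemma lf_acts_unique: "lf_acts f x y \<Longrightarrow> lf_acts f x z \<Longrightarrow> y = z"
proof -
  assume f: "lf_acts f x y" "lf_acts f x z"
  obtain s a where s: "f = Lfrac s a" "s \<noteq> 0" by (rule Lfrac_cases)
  with f obtain u v u' v' where uv: "u \<noteq> 0" "u * x = v * s" "u * y = v * a"
    "u' \<noteq> 0" "u' * x = v' * s" "u' * z = v' * a" by (auto simp: lf_acts_Lfrac)
  obtain w w' where w: "w \<noteq> 0" "w * u = w' * u'" using left_ore2 uv(1,4) by metis
  have "(w * v) * s = (w' * v') * s" using w uv by (metis mult.assoc)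
  hence "w * v = w' * v'" using s by simp
  hence "(w * u) * y = (w * u) * z" using w uv by (metis mult.assoc)
  moreover have "w * u \<noteq> 0" using w(1) uv(1) by simp
  ultimately show "y = z" by simp
qed

lemma lf_acts_ex: obtains u y where "u \<noteq> 0" "lf_acts f (u * x) y"
proof -
  obtain s a where s: "f = Lfrac s a" "s \<noteq> 0" by (rule Lfrac_cases)
  obtain u v where "u \<noteq> 0" "u * x = v * s" using left_ore[OF s(2)] by blast
  thus ?thesis using that[of u "v * a"] lf_acts_scale[OF lf_acts_self[OF s(2), of a], of v] s by simp
qed

lemma Lfrac_common_denom:
  obtains s a b where "s \<noteq> 0" "f = Lfrac s a" "g = Lfrac s b"
proof -
  obtain s a where s: "f = Lfrac s a" "s \<noteq> 0" by (rule Lfrac_cases)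
  obtain u b where u: "u \<noteq> 0" "lf_acts g (u * s) b" by (rule lf_acts_ex)
  thus ?thesis using that[of "u * s" "u * a" b] s by (simp add: Lfrac_expand lf_acts_iff)
qed

lemma Lfrac_common_denom3:
  obtains s a b c where "s \<noteq> 0" "f = Lfrac s a" "g = Lfrac s b" "h = Lfrac s c"
proof -
  obtain s a b where s: "s \<noteq> 0" "f = Lfrac s a" "g = Lfrac s b" by (rule Lfrac_common_denom)
  obtain u c where u: "u \<noteq> 0" "lf_acts h (u * s) c" by (rule lf_acts_ex)
  thus ?thesis using that[of "u * s" "u * a" "u * b" c] s by (simp add: Lfrac_expand lf_acts_iff)
qed

instantiation lfrac :: (left_ore_domain) division_ring
begin

definition zero_lfrac :: "'a lfrac" where "0 = Lfrac 1 0"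

definition one_lfrac :: "'a lfrac" where "1 = Lfrac 1 1"

definition plus_lfrac :: "'a lfrac \<Rightarrow> 'a lfrac \<Rightarrow> 'a lfrac" where
  "f + g = (THE h. \<exists>s a b. s \<noteq> 0 \<and> f = Lfrac s a \<and> g = Lfrac s b \<and> h = Lfrac s (a + b))"

definition times_lfrac :: "'a lfrac \<Rightarrow> 'a lfrac \<Rightarrow> 'a lfrac" where
  "f * g = (THE h. \<exists>s a t b u v. s \<noteq> 0 \<and> t \<noteq> 0 \<and> f = Lfrac s a \<and> g = Lfrac t b \<and>
     u \<noteq> 0 \<and> u * a = v * t \<and> h = Lfrac (u * s) (v * b))"

definition uminus_lfrac :: "'a lfrac \<Rightarrow> 'a lfrac" where
  "- f = (THE h. \<exists>s a. s \<noteq> 0 \<and> f = Lfrac s a \<and> h = Lfrac s (- a))"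

definition minus_lfrac :: "'a lfrac \<Rightarrow> 'a lfrac \<Rightarrow> 'a lfrac" where
  "f - g = f + - g" for f g :: "'a lfrac"

definition inverse_lfrac :: "'a lfrac \<Rightarrow> 'a lfrac" where
  "inverse f = (if f = 0 then 0 else THE h. \<exists>s a. s \<noteq> 0 \<and> a \<noteq> 0 \<and> f = Lfrac s a \<and> h = Lfrac a s)"

definition divide_lfrac :: "'a lfrac \<Rightarrow> 'a lfrac \<Rightarrow> 'a lfrac" where
  "f div g = f * inverse g" for f g :: "'a lfrac"

lemma Lfrac_eq_multiple:
  assumes "s \<noteq> 0" "t \<noteq> 0" "Lfrac s a = Lfrac t b" "u * s = v * t"
  shows "u * a = v * b"
  using lf_acts_scale[OF lf_acts_self[OF assms(1), of a], of u]
    lf_acts_scale[OF lf_acts_self[OF assms(2), of b], of v] assms(3,4) lf_acts_unique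
  by metis

lemma plus_Lfrac:
  assumes s: "s \<noteq> 0"
  shows "Lfrac s a + Lfrac s b = Lfrac s (a + b)"
  unfolding plus_lfrac_def
proof (rule the_equality)
  fix h assume "\<exists>t a' b'. t \<noteq> 0 \<and> Lfrac s a = Lfrac t a' \<and> Lfrac s b = Lfrac t b' \<and> h = Lfrac t (a' + b')"
  then obtain t a' b' where t: "t \<noteq> 0" "Lfrac s a = Lfrac t a'" "Lfrac s b = Lfrac t b'"
    "h = Lfrac t (a' + b')" by blast
  obtain u v where uv: "u \<noteq> 0" "v \<noteq> 0" "u * s = v * t" using left_ore2[OF s t(1)] .
  have "u * a = v * a'" "u * b = v * b'"
    using Lfrac_eq_multiple[OF s t(1) _ uv(3)] t by auto
  thus "h = Lfrac s (a + b)"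
    unfolding t(4) using t(1) uv s
    by (subst Lfrac_eq_iff) ((simp; fail)+, rule exI[of _ v], rule exI[of _ u], simp add: distrib_left)
qed (use s in blast)

lemma uminus_Lfrac:
  assumes s: "s \<noteq> 0"
  shows "- Lfrac s a = Lfrac s (- a)"
  unfolding uminus_lfrac_def
proof (rule the_equality)
  fix h assume "\<exists>t b. t \<noteq> 0 \<and> Lfrac s a = Lfrac t b \<and> h = Lfrac t (- b)"
  then obtain t b where t: "t \<noteq> 0" "Lfrac s a = Lfrac t b" "h = Lfrac t (- b)" by blast
  obtain u v where uv: "u \<noteq> 0" "v \<noteq> 0" "u * s = v * t" using left_ore2[OF s t(1)] .
  have "u * a = v * b" using Lfrac_eq_multiple[OF s t(1,2) uv(3)] .
  thus "h = Lfrac s (- a)"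
    unfolding t(3) using t(1) uv s
    by (subst Lfrac_eq_iff) ((simp; fail)+, rule exI[of _ v], rule exI[of _ u], simp add: distrib_left)
qed (use s in blast)

lemma times_Lfrac_Lfrac:
  assumes nz: "s \<noteq> 0" "t \<noteq> 0" "u \<noteq> 0" and eq: "u * a = v * t"
  shows "Lfrac s a * Lfrac t b = Lfrac (u * s) (v * b)"
  unfolding times_lfrac_def
proof (rule the_equality)
  fix h assume "\<exists>s' a' t' b' u' v'. s' \<noteq> 0 \<and> t' \<noteq> 0 \<and> Lfrac s a = Lfrac s' a' \<and>
    Lfrac t b = Lfrac t' b' \<and> u' \<noteq> 0 \<and> u' * a' = v' * t' \<and> h = Lfrac (u' * s') (v' * b')"
  then obtain s' a' t' b' u' v' where h: "s' \<noteq> 0" "t' \<noteq> 0" "Lfrac s a = Lfrac s' a'"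
    "Lfrac t b = Lfrac t' b'" "u' \<noteq> 0" "u' * a' = v' * t'" "h = Lfrac (u' * s') (v' * b')" by blast
  obtain p q where pq: "p \<noteq> 0" "q \<noteq> 0" "p * (u * s) = q * (u' * s')"
    using left_ore2[of "u * s" "u' * s'"] nz h by auto
  have "p * u * a = q * u' * a'"
    using Lfrac_eq_multiple[OF nz(1) h(1) h(3), of "p * u" "q * u'"] pq by (simp add: mult.assoc)
  hence "(p * v) * t = (q * v') * t'" using eq h(6) by (simp add: mult.assoc)
  hence "p * (v * b) = q * (v' * b')"
    using Lfrac_eq_multiple[OF nz(2) h(2) h(4), of "p * v" "q * v'"] by (simp add: mult.assoc)
  thus "h = Lfrac (u * s) (v * b)"
    unfolding h(7) using pq nz h(1,5)
    by (subst Lfrac_eq_iff) ((simp; fail)+, rule exI[of _ q], rule exI[of _ p], simp add: distrib_left)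
qed (use assms in blast)

lemma times_Lfrac:
  assumes s: "s \<noteq> 0" and g: "lf_acts g a b"
  shows "Lfrac s a * g = Lfrac s b"
proof -
  obtain t c where t: "g = Lfrac t c" "t \<noteq> 0" by (rule Lfrac_cases)
  with g obtain u v where "u \<noteq> 0" "u * a = v * t" "u * b = v * c" by (auto simp: lf_acts_Lfrac)
  with times_Lfrac_Lfrac[of s t u a v c] s t show ?thesis by (metis Lfrac_expand)
qed

lemma lf_acts_times: "lf_acts f x y \<Longrightarrow> lf_acts g y z \<Longrightarrow> x \<noteq> 0 \<Longrightarrow> lf_acts (f * g) x z"
  by (simp add: lf_acts_iff times_Lfrac)

lemma lf_acts_plus: "lf_acts f x y \<Longrightarrow> lf_acts g x z \<Longrightarrow> x \<noteq> 0 \<Longrightarrow> lf_acts (f + g) x (y + z)"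
  by (simp add: lf_acts_iff plus_Lfrac)

lemma lf_acts_add_arg: "lf_acts f x y \<Longrightarrow> lf_acts f x' y' \<Longrightarrow> lf_acts f (x + x') (y + y')"
proof -
  assume f: "lf_acts f x y" "lf_acts f x' y'"
  obtain s a where s: "f = Lfrac s a" "s \<noteq> 0" by (rule Lfrac_cases)
  with f obtain u v u' v' where uv: "u \<noteq> 0" "u * x = v * s" "u * y = v * a"
    "u' \<noteq> 0" "u' * x' = v' * s" "u' * y' = v' * a" by (auto simp: lf_acts_Lfrac)
  obtain w w' where w: "w \<noteq> 0" "w * u = w' * u'" using left_ore2 uv(1,4) by metis
  have "(w * u) * (x + x') = (w * v + w' * v') * s" "(w * u) * (y + y') = (w * v + w' * v') * a"
    by (simp_all add: distrib_left distrib_right mult.assoc uv(2,3))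
      (simp_all add: mult.assoc[symmetric] w(2), simp_all add: mult.assoc uv(5,6))
  moreover have "w * u \<noteq> 0" using w(1) uv(1) by simp
  ultimately have "\<exists>u v. u \<noteq> 0 \<and> u * (x + x') = v * s \<and> u * (y + y') = v * a" by blast
  thus ?thesis using s by (simp add: lf_acts_Lfrac)
qed

lemma Lfrac_zero: "s \<noteq> 0 \<Longrightarrow> Lfrac s 0 = 0"
  unfolding zero_lfrac_def using Lfrac_expand[of s 1 0] by simp

lemma Lfrac_one: "s \<noteq> 0 \<Longrightarrow> Lfrac s s = 1"
  unfolding one_lfrac_def using Lfrac_expand[of s 1 1] by simp

lemma lf_acts_1: "lf_acts 1 x x"
  by (auto simp: one_lfrac_def lf_acts_Lfrac intro!: exI[of _ 1])

lemma inverse_Lfrac: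
  assumes nz: "s \<noteq> 0" "a \<noteq> 0"
  shows "inverse (Lfrac s a) = Lfrac a s"
proof -
  have "Lfrac s a \<noteq> 0" using nz Lfrac_zero[OF nz(1)] by (metis Lfrac_same_denom)
  moreover have "(THE h. \<exists>t b. t \<noteq> 0 \<and> b \<noteq> 0 \<and> Lfrac s a = Lfrac t b \<and> h = Lfrac b t) = Lfrac a s"
  proof (rule the_equality)
    fix h assume "\<exists>t b. t \<noteq> 0 \<and> b \<noteq> 0 \<and> Lfrac s a = Lfrac t b \<and> h = Lfrac b t"
    then obtain t b where "t \<noteq> 0" "b \<noteq> 0" "Lfrac s a = Lfrac t b" "h = Lfrac b t" by blast
    note h = this
    obtain u v where uv: "u \<noteq> 0" "v \<noteq> 0" "u * s = v * t" using left_ore2[OF nz(1) h(1)] .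
    have "u * a = v * b" using Lfrac_eq_multiple[OF nz(1) h(1,3) uv(3)] .
    thus "h = Lfrac a s"
      unfolding h(4) using h(2) nz uv
      by (subst Lfrac_eq_iff) ((simp; fail)+, rule exI[of _ v], rule exI[of _ u], simp add: distrib_left)
  qed (use nz in blast)
  ultimately show ?thesis by (simp add: inverse_lfrac_def)
qed

instance
proof
  fix f g h :: "'a lfrac"
  show "f + g + h = f + (g + h)" 
    by (rule Lfrac_common_denom3[of f g h]) (simp add: plus_Lfrac add.assoc)
  show "f + g = g + f"
    by (rule Lfrac_common_denom[of f g]) (simp add: plus_Lfrac add.commute)
  show "0 + f = f"
    by (rule Lfrac_cases[of f]) (metis Lfrac_zero plus_Lfrac add_0)
  show "- f + f = 0"
    by (rule Lfrac_cases[of f]) (simp add: uminus_Lfrac plus_Lfrac Lfrac_zero)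
  show "f - g = f + - g" by (rule minus_lfrac_def)
  show "f * g * h = f * (g * h)"
  proof -
    obtain s a where s: "f = Lfrac s a" "s \<noteq> 0" by (rule Lfrac_cases)
    obtain u b where u: "u \<noteq> 0" "lf_acts g (u * a) b" by (rule lf_acts_ex)
    obtain w c where w: "w \<noteq> 0" "lf_acts h (w * b) c" by (rule lf_acts_ex)
    define r x y where "r = w * (u * s)" and "x = w * (u * a)" and "y = w * b"
    have r: "r \<noteq> 0" "f = Lfrac r x" using s u w by (simp_all add: r_def x_def Lfrac_expand)
    have g: "lf_acts g x y" using u(2) by (simp add: x_def y_def lf_acts_scale)
    have h: "lf_acts h y c" using w by (simp add: y_def)
    have "f * g * h = Lfrac r c" using r g h by (simp add: times_Lfrac)
    moreover have "f * (g * h) = Lfrac r c"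
    proof (cases "x = 0")
      case False
      thus ?thesis using r g h by (simp add: times_Lfrac lf_acts_times)
    next
      case True
      have 0: "lf_acts k 0 0" for k :: "'a lfrac"
        by (rule lf_acts_ex[of k 1]) (drule lf_acts_scale[of _ _ _ 0], simp)
      have "y = 0" using lf_acts_unique[of g x y 0] 0[of g] g True by simp
      hence "c = 0" using lf_acts_unique[of h y c 0] 0[of h] h by simp
      thus ?thesis using r True 0[of "g * h"] by (simp add: times_Lfrac)
    qed
    ultimately show ?thesis by simp
  qed
  show "1 * f = f"
    by (rule Lfrac_cases[of f]) (metis Lfrac_one times_Lfrac lf_acts_self)
  show "f * 1 = f"
    by (rule Lfrac_cases[of f]) (simp add: times_Lfrac lf_acts_1)
  show "(f + g) * h = f * h + g * h"
  proof -
    obtain s a b where s: "s \<noteq> 0" "f = Lfrac s a" "g = Lfrac s b" by (rule Lfrac_common_denom)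
    obtain u c where u: "u \<noteq> 0" "lf_acts h (u * a) c" by (rule lf_acts_ex)
    obtain w d where w: "w \<noteq> 0" "lf_acts h (w * (u * b)) d" by (rule lf_acts_ex)
    define r x y where "r = w * (u * s)" and "x = w * (u * a)" and "y = w * (u * b)"
    have r: "r \<noteq> 0" "f = Lfrac r x" "g = Lfrac r y" 
      using s u w by (simp_all add: r_def x_def y_def Lfrac_expand)
    have "lf_acts h x (w * c)" "lf_acts h y d"
      using u w by (simp_all add: x_def y_def lf_acts_scale)
    thus ?thesis using r by (simp add: plus_Lfrac times_Lfrac lf_acts_add_arg)
  qed
  show "f * (g + h) = f * g + f * h"
  proof -
    obtain s a where s: "f = Lfrac s a" "s \<noteq> 0" by (rule Lfrac_cases)
    obtain t b c where t: "t \<noteq> 0" "g = Lfrac t b" "h = Lfrac t c" by (rule Lfrac_common_denom)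
    obtain u v where uv: "u \<noteq> 0" "u * a = v * t" using left_ore[OF t(1)] by blast
    have "u * s \<noteq> 0" using s uv by simp
    moreover have "f * (g + h) = Lfrac (u * s) (v * (b + c))" "f * g = Lfrac (u * s) (v * b)"
      "f * h = Lfrac (u * s) (v * c)"
      using s t uv by (simp_all add: plus_Lfrac times_Lfrac_Lfrac)
    ultimately show ?thesis by (simp add: plus_Lfrac distrib_left)
  qed
  show "(0::'a lfrac) \<noteq> 1"
    unfolding zero_lfrac_def one_lfrac_def by simp
  show "inverse (0::'a lfrac) = 0" by (simp add: inverse_lfrac_def)
  show "f div g = f * inverse g" by (rule divide_lfrac_def)
  assume f: "f \<noteq> 0"
  obtain s a where s: "f = Lfrac s a" "s \<noteq> 0" by (rule Lfrac_cases)
  have a: "a \<noteq> 0" using f s by (auto simp: Lfrac_zero)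
  show "inverse f * f = 1" "f * inverse f = 1"
    unfolding s(1) inverse_Lfrac[OF s(2) a]
    by (simp_all add: times_Lfrac[OF a lf_acts_self[OF s(2)]] times_Lfrac[OF s(2) lf_acts_self[OF a]]
        Lfrac_one s(2) a)
qed

end

definition lf_of :: "'a::left_ore_domain \<Rightarrow> 'a lfrac" where
  "lf_of a = Lfrac 1 a"

lemma lf_of_0 [simp]: "lf_of 0 = 0" and lf_of_1 [simp]: "lf_of 1 = 1"
  by (simp_all add: lf_of_def zero_lfrac_def one_lfrac_def)

lemma lf_of_add: "lf_of (a + b) = lf_of a + lf_of b"
  by (simp add: lf_of_def plus_Lfrac)

lemma lf_acts_lf_of: "lf_acts (lf_of a) x (x * a)"
  unfolding lf_of_def by (subst lf_acts_Lfrac, simp, rule exI[of _ 1], rule exI[of _ x], simp)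

lemma lf_of_mult: "lf_of (a * b) = lf_of a * lf_of b"
  using times_Lfrac[of 1 "lf_of b" a "a * b"] lf_acts_lf_of[of b a] by (simp add: lf_of_def)

lemma lf_of_eq_iff [simp]: "lf_of a = lf_of b \<longleftrightarrow> a = b"
  by (simp add: lf_of_def)

lemma Lfrac_conv_inverse: "s \<noteq> 0 \<Longrightarrow> Lfrac s a = inverse (lf_of s) * lf_of a"
  using times_Lfrac[of s "lf_of a" 1 a] lf_acts_lf_of[of a 1]
  by (simp add: lf_of_def[of s] inverse_Lfrac)

lemma coeff_sum_bound:
  fixes F :: "'a::zero \<Rightarrow> nat \<Rightarrow> 'b::comm_monoid_add"
  assumes "\<And>i. F 0 i = 0" "degree l \<le> n"
  shows "(\<Sum>i\<le>degree l. F (coeff l i) i) = (\<Sum>i\<le>n. F (coeff l i) i)"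
  by (rule sum.mono_neutral_left) (use assms in \<open>auto simp: coeff_eq_0\<close>)

lemma coeff_sum_add:
  fixes F :: "'a::comm_monoid_add \<Rightarrow> nat \<Rightarrow> 'b::comm_monoid_add"
  assumes 0: "\<And>i. F 0 i = 0" and add: "\<And>a b i. F (a + b) i = F a i + F b i"
  shows "(\<Sum>i\<le>degree (l + m). F (coeff (l + m) i) i)
    = (\<Sum>i\<le>degree l. F (coeff l i) i) + (\<Sum>i\<le>degree m. F (coeff m i) i)"
proof -
  let ?n = "max (degree l) (degree m)"
  have "degree (l + m) \<le> ?n" by (simp add: degree_add_le)
  thus ?thesis
    using coeff_sum_bound[of F "l + m" ?n, OF 0] coeff_sum_bound[of F l ?n, OF 0]
      coeff_sum_bound[of F m ?n, OF 0]
    by (simp add: add sum.distrib)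
qed

text \<open>\<open>Weyl l\<close> stands for the sum of \<open>coeff l i * \<partial> ^ i\<close>, coefficients on the left;
  \<open>dmul\<close> is left multiplication by \<open>\<partial>\<close>, that is, \<open>\<partial> p = p \<partial> + p'\<close> applied coefficientwise.\<close>

datatype weyl = Weyl (wcoeffs: "rat poly poly")

definition dmul :: "rat poly poly \<Rightarrow> rat poly poly" where
  "dmul m = pCons 0 m + map_poly pderiv m"

definition weyl_mult :: "rat poly poly \<Rightarrow> rat poly poly \<Rightarrow> rat poly poly" where
  "weyl_mult l m = (\<Sum>i\<le>degree l. smult (coeff l i) ((dmul ^^ i) m))"

lemma coeff_dmul: "coeff (dmul m) i = (case i of 0 \<Rightarrow> 0 | Suc j \<Rightarrow> coeff m j) + pderiv (coeff m i)"
  by (simp add: dmul_def coeff_map_poly coeff_pCons)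

lemma dmul_add: "dmul (a + b) = dmul a + dmul b"
  by (rule poly_eqI) (simp add: coeff_dmul pderiv_add split: nat.split)

lemma dmul_0 [simp]: "dmul 0 = 0"
  by (simp add: dmul_def)

lemma dmul_smult: "dmul (smult p m) = smult p (dmul m) + smult (pderiv p) m"
  by (rule poly_eqI) (simp add: coeff_dmul pderiv_mult algebra_simps split: nat.split)

lemma dmul_sum: "dmul (sum f A) = (\<Sum>i\<in>A. dmul (f i))"
  by (induction A rule: infinite_finite_induct) (auto simp: dmul_add)

lemma dmul_pow_add: "(dmul ^^ i) (a + b) = (dmul ^^ i) a + (dmul ^^ i) b"
  by (induction i) (auto simp: dmul_add)

lemma dmul_pow_1: "(dmul ^^ i) 1 = monom 1 i"
proof (induction i)
  case (Suc i)
  have "dmul (monom 1 i) = monom 1 (Suc i)"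
    by (rule poly_eqI) (simp add: coeff_dmul split: nat.split)
  with Suc show ?case by simp
qed (simp add: monom_0 one_pCons)

lemma weyl_mult_add_left: "weyl_mult (a + b) c = weyl_mult a c + weyl_mult b c"
  unfolding weyl_mult_def by (rule coeff_sum_add) (auto simp: smult_add_left)

lemma weyl_mult_add_right: "weyl_mult a (b + c) = weyl_mult a b + weyl_mult a c"
  by (simp add: weyl_mult_def dmul_pow_add smult_add_right sum.distrib)

lemma smult_sum_right: "smult p (sum f A) = (\<Sum>i\<in>A. smult p (f i))" for f :: "'b \<Rightarrow> 'a::comm_semiring_0 poly"
  by (induction A rule: infinite_finite_induct) (auto simp: smult_add_right)

lemma weyl_mult_0_left: "weyl_mult 0 c = 0"
  by (simp add: weyl_mult_def)

lemma weyl_mult_smult: "weyl_mult (smult p b) c = smult p (weyl_mult b c)"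
proof -
  have "weyl_mult (smult p b) c = (\<Sum>i\<le>degree b. smult (coeff (smult p b) i) ((dmul ^^ i) c))"
    unfolding weyl_mult_def
    by (rule coeff_sum_bound[of "\<lambda>a i. smult a ((dmul ^^ i) c)"]) (auto simp: degree_smult_le)
  also have "\<dots> = smult p (weyl_mult b c)" 
    unfolding weyl_mult_def by (simp add: smult_sum_right)
  finally show ?thesis .
qed

lemma weyl_mult_monom: "weyl_mult (monom p i) c = smult p ((dmul ^^ i) c)"
proof -
  have "weyl_mult (monom p i) c = (\<Sum>j\<le>i. smult (coeff (monom p i) j) ((dmul ^^ j) c))"
    unfolding weyl_mult_def
    by (rule coeff_sum_bound[of "\<lambda>a i. smult a ((dmul ^^ i) c)"]) (auto simp: degree_monom_le)
  also have "\<dots> = (\<Sum>j\<in>{i}. smult (coeff (monom p i) j) ((dmul ^^ j) c))"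
    by (rule sum.mono_neutral_right) auto
  finally show ?thesis by simp
qed

lemma weyl_mult_sum_left: "weyl_mult (sum f A) c = (\<Sum>i\<in>A. weyl_mult (f i) c)"
  by (induction A rule: infinite_finite_induct) (auto simp: weyl_mult_add_left weyl_mult_0_left)

lemma weyl_mult_dmul: "weyl_mult (dmul b) c = dmul (weyl_mult b c)"
proof -
  have mon: "weyl_mult (dmul (monom p i)) c = dmul (weyl_mult (monom p i) c)" for p i
  proof -
    have "dmul (monom p i) = monom p (Suc i) + monom (pderiv p) i"
      by (rule poly_eqI) (auto simp: coeff_dmul split: nat.split)
    thus ?thesis by (simp add: weyl_mult_add_left weyl_mult_monom dmul_smult)
  qed
  have "weyl_mult (dmul (\<Sum>i\<le>degree b. monom (coeff b i) i)) c
      = dmul (weyl_mult (\<Sum>i\<le>degree b. monom (coeff b i) i) c)"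
    by (simp add: dmul_sum weyl_mult_sum_left mon)
  thus ?thesis by (simp add: poly_as_sum_of_monoms)
qed

lemma weyl_mult_assoc: "weyl_mult (weyl_mult a b) c = weyl_mult a (weyl_mult b c)"
proof -
  have "(dmul ^^ i) (weyl_mult b c) = weyl_mult ((dmul ^^ i) b) c" for i
    by (induction i) (auto simp: weyl_mult_dmul)
  thus ?thesis
    by (simp add: weyl_mult_def[of a] weyl_mult_sum_left weyl_mult_smult)
qed

instantiation weyl :: ring_1
begin

definition zero_weyl :: weyl where "0 = Weyl 0"
definition one_weyl :: weyl where "1 = Weyl 1"
definition plus_weyl :: "weyl \<Rightarrow> weyl \<Rightarrow> weyl" where "L + M = Weyl (wcoeffs L + wcoeffs M)"
definition uminus_weyl :: "weyl \<Rightarrow> weyl" where "- L = Weyl (- wcoeffs L)"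
definition minus_weyl :: "weyl \<Rightarrow> weyl \<Rightarrow> weyl" where "L - M = Weyl (wcoeffs L - wcoeffs M)"
definition times_weyl :: "weyl \<Rightarrow> weyl \<Rightarrow> weyl" where
  "L * M = Weyl (weyl_mult (wcoeffs L) (wcoeffs M))"

instance
proof
  fix L M N :: weyl
  show "L + M + N = L + (M + N)" "L + M = M + L" "0 + L = L" "- L + L = 0" "L - M = L + - M"
    by (simp_all add: zero_weyl_def plus_weyl_def uminus_weyl_def minus_weyl_def add_ac)
  show "L * M * N = L * (M * N)" by (simp add: times_weyl_def weyl_mult_assoc)
  show "(L + M) * N = L * N + M * N" "L * (M + N) = L * M + L * N"
    by (simp_all add: times_weyl_def plus_weyl_def weyl_mult_add_left weyl_mult_add_right)
  show "1 * L = L" by (simp add: times_weyl_def one_weyl_def weyl_mult_def)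
  show "L * 1 = L"
    by (simp add: times_weyl_def one_weyl_def weyl_mult_def dmul_pow_1 smult_monom poly_as_sum_of_monoms)
  show "(0::weyl) \<noteq> 1" by (simp add: zero_weyl_def one_weyl_def)
qed

end

definition weyl_poly :: "rat poly \<Rightarrow> weyl" where
  "weyl_poly p = Weyl [:p:]"

definition weyl_D :: weyl where
  "weyl_D = Weyl [:0, 1:]"

lemma weyl_poly_add: "weyl_poly (p + q) = weyl_poly p + weyl_poly q"
  by (simp add: weyl_poly_def plus_weyl_def)

lemma weyl_poly_mult: "weyl_poly (p * q) = weyl_poly p * weyl_poly q"
  by (simp add: weyl_poly_def times_weyl_def weyl_mult_def)

lemma weyl_D_x: "weyl_D * weyl_poly [:0, 1:] = weyl_poly [:0, 1:] * weyl_D + 1"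
  by (simp add: weyl_D_def weyl_poly_def times_weyl_def plus_weyl_def one_weyl_def weyl_mult_def
      dmul_def map_poly_pCons pderiv_pCons one_pCons)

lemma weyl_normal_form: "(\<Sum>i\<le>degree l. weyl_poly (coeff l i) * weyl_D ^ i) = Weyl l"
proof -
  have pow: "weyl_D ^ i = Weyl (monom 1 i)" for i
  proof (induction i)
    case (Suc i)
    have "monom 1 (Suc i) = weyl_mult [:0, 1:] (monom (1::rat poly) i)"
      using dmul_pow_1[of "Suc i"] dmul_pow_1[of i] by (simp add: weyl_mult_def)
    with Suc show ?case by (simp add: weyl_D_def times_weyl_def)
  qed (simp add: one_weyl_def monom_0 one_pCons)
  have monom: "weyl_poly p * weyl_D ^ i = Weyl (monom p i)" for p i
    unfolding pow by (simp add: weyl_poly_def times_weyl_def weyl_mult_def smult_monom)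
  have sum: "(\<Sum>i\<in>A. Weyl (f i)) = Weyl (sum f A)" for f and A :: "nat set"
    by (induction A rule: infinite_finite_induct) (auto simp: zero_weyl_def plus_weyl_def)
  show ?thesis by (simp add: monom sum poly_as_sum_of_monoms)
qed

definition sconst :: "ratfun \<Rightarrow> skew_laurent" where
  "sconst a = smonom a 0"

definition shiftS :: skew_laurent where "shiftS = smonom 1 1"
definition shiftSinv :: skew_laurent where "shiftSinv = smonom 1 (-1)"

definition rat_n :: ratfun where "rat_n = to_fract [:0, 1:]"

lemma shiftS_inverse: "shiftS * shiftSinv = 1" "shiftSinv * shiftS = 1"
  by (simp_all add: shiftS_def shiftSinv_def smonom_times_smonom one_skew_laurent_def)

lemma shiftS_commute: "shiftS * sconst a = sconst (shift 1 a) * shiftS"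
  by (simp add: shiftS_def sconst_def smonom_times_smonom)

definition chebX :: skew_laurent where
  "chebX = sconst (1 / 2) * (shiftS + shiftSinv)"

definition chebDden :: skew_laurent where "chebDden = shiftSinv - shiftS"
definition chebDnum :: skew_laurent where "chebDnum = sconst (2 * rat_n)"

definition chebD :: "skew_laurent lfrac" where
  "chebD = Lfrac chebDden chebDnum"

definition poly_at_X :: "rat poly \<Rightarrow> skew_laurent" where
  "poly_at_X p = (\<Sum>i\<le>degree p. sconst (to_fract [:coeff p i:]) * chebX ^ i)"

text \<open>\<open>cheb_phi\<close> is given on normal forms; \<open>cheb_phi_add\<close>, \<open>cheb_phi_mult\<close>, \<open>cheb_phi_const\<close>,
  \<open>cheb_phi_x\<close> and \<open>cheb_phi_D\<close> below show that it is the rational algebra morphism with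
  \<open>x \<mapsto> X\<close> and \<open>\<partial> \<mapsto> D\<close>.\<close>

definition cheb_phi :: "weyl \<Rightarrow> skew_laurent lfrac" where
  "cheb_phi L = (\<Sum>i\<le>degree (wcoeffs L). lf_of (poly_at_X (coeff (wcoeffs L) i)) * chebD ^ i)"

lemma sconst_add: "sconst (a + b) = sconst a + sconst b"
  by (simp add: sconst_def smonom_add)

lemma sconst_mult: "sconst (a * b) = sconst a * sconst b"
  by (simp add: sconst_def smonom_times_smonom)

lemma sconst_0 [simp]: "sconst 0 = 0"
  by (rule skew_laurent_eqI) (simp add: sconst_def scoeff_simps)

lemma sconst_1 [simp]: "sconst 1 = 1"
  by (simp add: sconst_def one_skew_laurent_def)

lemma shift_const [simp]: "shift k (to_fract [:c:]) = to_fract [:c:]"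
  by (simp add: to_fract_def shift_Fract pcompose_1)

lemma to_fract_const_1 [simp]: "to_fract [:1:] = 1"
  by (simp flip: one_pCons)

lemma shift_half [simp]: "shift k (1 / 2) = 1 / 2"
proof -
  have "(1 / 2 :: ratfun) = to_fract [:1 / 2:]"
  proof -
    have "2 * to_fract [:1 / 2 :: rat:] = to_fract (2 * [:1 / 2:])"
      by (simp only: mult_2 to_fract_add)
    also have "2 * [:1 / 2 :: rat:] = 1" by (simp only: mult_2) (simp add: one_pCons)
    finally have "2 * to_fract [:1 / 2 :: rat:] = 1" by simp
    thus ?thesis by (metis nonzero_mult_div_cancel_left zero_neq_one mult_zero_left)
  qed
  thus ?thesis by (simp only: shift_const)
qed

lemma shift_n: "shift k rat_n = rat_n + of_int k"
proof -
  have "of_int k = to_fract [:of_int k :: rat:]"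
  proof -
    have nat: "of_nat n = to_fract [:of_nat n :: rat:]" for n
    proof (induction n)
      case (Suc n)
      have "[:of_nat (Suc n) :: rat:] = 1 + [:of_nat n:]" by (simp add: one_pCons)
      hence "to_fract [:of_nat (Suc n) :: rat:] = 1 + to_fract [:of_nat n:]"
        by (simp only: to_fract_add to_fract_1)
      moreover have "of_nat (Suc n) = (1 :: ratfun) + of_nat n" by simp
      ultimately show ?case using Suc by simp
    qed simp
    show ?thesis
    proof (cases k rule: int_cases2)
      case (nonpos n)
      have "to_fract [:- of_nat n :: rat:] = - of_nat n"
        using to_fract_uminus[of "[:of_nat n :: rat:]"] by (simp add: nat)
      with nonpos show ?thesis by simp
    qed (simp add: nat)
  qed
  thus ?thesis
    by (simp add: rat_n_def to_fract_def shift_Fract pcompose_pCons pcompose_1)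
qed

lemma chebX_eq: "chebX = smonom (1 / 2) 1 + smonom (1 / 2) (- 1)"
  by (simp add: chebX_def sconst_def shiftS_def shiftSinv_def distrib_left smonom_times_smonom)

lemma chebDden_eq: "chebDden = smonom 1 (- 1) - smonom 1 1"
  by (simp add: chebDden_def shiftS_def shiftSinv_def)

lemma chebDden_nz [simp]: "chebDden \<noteq> 0"
proof
  assume "chebDden = 0"
  hence "scoeff chebDden 1 = scoeff 0 1" by simp
  thus False by (simp add: chebDden_eq scoeff_simps)
qed

lemma chebDden_chebX: "chebDden * chebX = chebX * chebDden"
  by (simp add: chebX_eq chebDden_eq algebra_simps smonom_times_smonom)

lemma shift_2 [simp]: "shift k 2 = 2"
  using shift_add[of k 1 1] by simp

lemma chebDnum_chebX: "chebDnum * chebX = chebX * chebDnum + chebDden"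
proof -
  have 2: "(2::ratfun) \<noteq> 0" by simp
  show ?thesis
    by (rule skew_laurent_eqI)
      (simp add: chebX_eq chebDden_eq chebDnum_def sconst_def algebra_simps smonom_times_smonom
        scoeff_simps shift_mult shift_n)
qed

lemma const_chebX: "sconst (to_fract [:c:]) * chebX = chebX * sconst (to_fract [:c:])"
  by (simp add: chebX_eq sconst_def distrib_left distrib_right smonom_times_smonom mult.commute)

lemma const_chebDden: "sconst (to_fract [:c:]) * chebDden = chebDden * sconst (to_fract [:c:])"
  by (simp add: chebDden_eq sconst_def algebra_simps smonom_times_smonom)

lemma const_chebDnum: "sconst (to_fract [:c:]) * chebDnum = chebDnum * sconst (to_fract [:c:])"
  by (simp add: chebDnum_def mult.commute flip: sconst_mult)

lemma poly_at_X_0 [simp]: "poly_at_X 0 = 0"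
  by (simp add: poly_at_X_def)

lemma poly_at_X_const: "poly_at_X [:c:] = sconst (to_fract [:c:])"
  by (simp add: poly_at_X_def)

lemma poly_at_X_1 [simp]: "poly_at_X 1 = 1"
  by (simp add: one_pCons poly_at_X_const)

lemma poly_at_X_add: "poly_at_X (p + q) = poly_at_X p + poly_at_X q"
proof -
  have "[:a + b:] = [:a:] + [:b:]" for a b :: rat by simp
  thus ?thesis
    unfolding poly_at_X_def
    by (intro coeff_sum_add) (auto simp: sconst_add distrib_right simp del: add_pCons)
qed

lemma chebX_pow_const: "chebX ^ i * sconst (to_fract [:c:]) = sconst (to_fract [:c:]) * chebX ^ i"
  by (induction i) (simp_all add: mult.assoc, metis const_chebX mult.assoc)

lemma poly_at_X_pCons: "poly_at_X (pCons c p) = sconst (to_fract [:c:]) + chebX * poly_at_X p"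
proof -
  have "poly_at_X (pCons 0 p)
      = (\<Sum>i\<le>Suc (degree p). sconst (to_fract [:coeff (pCons 0 p) i:]) * chebX ^ i)"
    unfolding poly_at_X_def
    by (rule coeff_sum_bound[of "\<lambda>a i. sconst (to_fract [:a:]) * chebX ^ i"]) (auto simp: degree_pCons_le)
  also have "\<dots> = (\<Sum>i\<le>degree p. sconst (to_fract [:coeff p i:]) * chebX ^ Suc i)"
    by (subst sum.atMost_Suc_shift) simp
  also have "\<dots> = chebX * poly_at_X p"
    unfolding poly_at_X_def sum_distrib_left
    by (rule sum.cong) (simp_all add: const_chebX flip: mult.assoc)
  finally have 1: "poly_at_X (pCons 0 p) = chebX * poly_at_X p" .
  have "pCons c p = [:c:] + pCons 0 p" by simp
  thus ?thesis by (metis 1 poly_at_X_add poly_at_X_const)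
qed

lemma poly_at_X_mult: "poly_at_X (p * q) = poly_at_X p * poly_at_X q"
proof (induction p)
  case (pCons c p)
  have "poly_at_X (smult c q) = sconst (to_fract [:c:]) * poly_at_X q"
  proof (induction q)
    case (pCons d q)
    have "to_fract [:c * d:] = to_fract [:c:] * to_fract [:d:]" by (simp flip: to_fract_mult)
    with pCons show ?case
      by (simp add: poly_at_X_pCons sconst_mult distrib_left)
        (simp add: const_chebX flip: mult.assoc)
  qed simp
  with pCons show ?case
    by (simp add: poly_at_X_pCons poly_at_X_add mult.assoc distrib_right)
qed simp

lemma lf_of_chebDden_commute:
  assumes "a * chebDden = chebDden * a"
  shows "lf_of a * inverse (lf_of chebDden) = inverse (lf_of chebDden) * lf_of a"
proof -
  have nz: "lf_of chebDden \<noteq> 0" using lf_of_eq_iff[of chebDden 0] by simp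
  have "lf_of a * lf_of chebDden = lf_of chebDden * lf_of a"
    using assms by (simp flip: lf_of_mult)
  hence "inverse (lf_of chebDden) * (lf_of a * lf_of chebDden) * inverse (lf_of chebDden)
      = inverse (lf_of chebDden) * (lf_of chebDden * lf_of a) * inverse (lf_of chebDden)" by simp
  hence "inverse (lf_of chebDden) * lf_of a * (lf_of chebDden * inverse (lf_of chebDden))
      = (inverse (lf_of chebDden) * lf_of chebDden) * lf_of a * inverse (lf_of chebDden)"
    by (simp only: mult.assoc)
  thus ?thesis using nz by simp
qed

lemma chebD_eq: "chebD = inverse (lf_of chebDden) * lf_of chebDnum"
  by (simp add: chebD_def Lfrac_conv_inverse)

lemma chebD_const: "chebD * lf_of (sconst (to_fract [:c:])) = lf_of (sconst (to_fract [:c:])) * chebD"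
proof -
  let ?c = "sconst (to_fract [:c:])" and ?i = "inverse (lf_of chebDden)"
  have "chebD * lf_of ?c = ?i * lf_of (chebDnum * ?c)" by (simp add: chebD_eq lf_of_mult mult.assoc)
  also have "\<dots> = ?i * lf_of ?c * lf_of chebDnum"
    by (simp add: const_chebDnum[symmetric] lf_of_mult mult.assoc)
  also have "\<dots> = lf_of ?c * chebD"
    by (simp add: chebD_eq lf_of_chebDden_commute[OF const_chebDden, symmetric] mult.assoc)
  finally show ?thesis .
qed

lemma chebD_chebX: "chebD * lf_of chebX = lf_of chebX * chebD + 1"
proof -
  let ?i = "inverse (lf_of chebDden)"
  have nz: "lf_of chebDden \<noteq> 0" using lf_of_eq_iff[of chebDden 0] by simp
  have "chebD * lf_of chebX = ?i * lf_of (chebDnum * chebX)" by (simp add: chebD_eq lf_of_mult mult.assoc)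
  also have "\<dots> = ?i * lf_of chebX * lf_of chebDnum + 1"
    using nz by (simp add: chebDnum_chebX lf_of_mult lf_of_add mult.assoc distrib_left)
  also have "\<dots> = lf_of chebX * chebD + 1"
    by (simp add: chebD_eq lf_of_chebDden_commute[OF chebDden_chebX[symmetric], symmetric] mult.assoc)
  finally show ?thesis .
qed

lemma chebD_poly_at_X:
  "chebD * lf_of (poly_at_X p) = lf_of (poly_at_X p) * chebD + lf_of (poly_at_X (pderiv p))"
proof (induction p)
  case (pCons c p)
  have "chebD * lf_of (poly_at_X (pCons c p))
      = lf_of (sconst (to_fract [:c:])) * chebD + (lf_of chebX * chebD + 1) * lf_of (poly_at_X p)"
    by (simp add: poly_at_X_pCons lf_of_add lf_of_mult distrib_left chebD_const flip: mult.assoc)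
      (simp add: chebD_chebX)
  also have "\<dots> = lf_of (sconst (to_fract [:c:])) * chebD
      + lf_of chebX * (lf_of (poly_at_X p) * chebD + lf_of (poly_at_X (pderiv p))) + lf_of (poly_at_X p)"
    by (simp add: distrib_right mult.assoc pCons.IH)
  also have "\<dots> = lf_of (poly_at_X (pCons c p)) * chebD + lf_of (poly_at_X (pderiv (pCons c p)))"
    by (simp add: pderiv_pCons poly_at_X_pCons poly_at_X_add lf_of_add lf_of_mult distrib_left
        distrib_right mult.assoc add_ac)
  finally show ?case .
qed simp

lemma cheb_phi_add: "cheb_phi (L + M) = cheb_phi L + cheb_phi M"
  unfolding cheb_phi_def plus_weyl_def weyl.sel
  by (rule coeff_sum_add) (auto simp: poly_at_X_add lf_of_add distrib_right)

lemma cheb_phi_0 [simp]: "cheb_phi 0 = 0"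
  by (simp add: cheb_phi_def zero_weyl_def)

lemma cheb_phi_bound: "degree l \<le> n \<Longrightarrow>
  cheb_phi (Weyl l) = (\<Sum>i\<le>n. lf_of (poly_at_X (coeff l i)) * chebD ^ i)"
  unfolding cheb_phi_def weyl.sel by (rule coeff_sum_bound) auto

lemma cheb_phi_smult: "cheb_phi (Weyl (smult p l)) = lf_of (poly_at_X p) * cheb_phi (Weyl l)"
  by (subst cheb_phi_bound[of _ "degree l"])
    (auto simp: cheb_phi_bound[of l "degree l"] degree_smult_le poly_at_X_mult lf_of_mult
      sum_distrib_left mult.assoc)

lemma cheb_phi_dmul: "cheb_phi (Weyl (dmul m)) = chebD * cheb_phi (Weyl m)"
proof -
  let ?d = "degree m" and ?f = "\<lambda>p. lf_of (poly_at_X p)"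
  have "cheb_phi (Weyl (dmul m)) = cheb_phi (Weyl (pCons 0 m)) + cheb_phi (Weyl (map_poly pderiv m))"
    using cheb_phi_add[of "Weyl (pCons 0 m)" "Weyl (map_poly pderiv m)"]
    by (simp add: plus_weyl_def dmul_def)
  also have "cheb_phi (Weyl (pCons 0 m)) = (\<Sum>i\<le>?d. ?f (coeff m i) * chebD ^ Suc i)"
    by (subst cheb_phi_bound[of _ "Suc ?d"], simp add: degree_pCons_le)
      (subst sum.atMost_Suc_shift, simp)
  also have "cheb_phi (Weyl (map_poly pderiv m)) = (\<Sum>i\<le>?d. ?f (pderiv (coeff m i)) * chebD ^ i)"
    by (subst cheb_phi_bound[of _ ?d]) (auto intro: degree_le simp: coeff_map_poly coeff_eq_0)
  also have "(\<Sum>i\<le>?d. ?f (coeff m i) * chebD ^ Suc i) + (\<Sum>i\<le>?d. ?f (pderiv (coeff m i)) * chebD ^ i)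
      = (\<Sum>i\<le>?d. (?f (coeff m i) * chebD + ?f (pderiv (coeff m i))) * chebD ^ i)"
    by (simp add: distrib_right sum.distrib mult.assoc)
  also have "\<dots> = chebD * cheb_phi (Weyl m)"
    by (simp add: chebD_poly_at_X[symmetric] cheb_phi_bound[of m ?d] sum_distrib_left mult.assoc)
  finally show ?thesis .
qed

lemma cheb_phi_mult: "cheb_phi (L * M) = cheb_phi L * cheb_phi M"
proof -
  have sum: "cheb_phi (Weyl (sum f A)) = (\<Sum>i\<in>A. cheb_phi (Weyl (f i)))" for f and A :: "nat set"
  proof (induction A rule: infinite_finite_induct)
    case (insert i A)
    thus ?case using cheb_phi_add[of "Weyl (f i)" "Weyl (sum f A)"] by (simp add: plus_weyl_def)
  qed (use cheb_phi_0 in \<open>simp_all add: zero_weyl_def\<close>)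
  have "cheb_phi (Weyl ((dmul ^^ i) m)) = chebD ^ i * cheb_phi (Weyl m)" for i m
    by (induction i) (auto simp: cheb_phi_dmul mult.assoc)
  hence "cheb_phi (L * M) = (\<Sum>i\<le>degree (wcoeffs L).
      lf_of (poly_at_X (coeff (wcoeffs L) i)) * (chebD ^ i * cheb_phi M))"
    by (simp add: times_weyl_def weyl_mult_def sum cheb_phi_smult)
  also have "\<dots> = cheb_phi L * cheb_phi M"
    by (simp add: cheb_phi_def[of L] sum_distrib_right mult.assoc)
  finally show ?thesis .
qed

lemma cheb_phi_poly: "cheb_phi (weyl_poly p) = lf_of (poly_at_X p)"
  by (simp add: cheb_phi_def weyl_poly_def)

lemma cheb_phi_1 [simp]: "cheb_phi 1 = 1"
  using cheb_phi_poly[of 1] by (simp add: weyl_poly_def one_weyl_def flip: one_pCons)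

lemma cheb_phi_const: "cheb_phi (weyl_poly [:c:]) = lf_of (sconst (to_fract [:c:]))"
  by (simp add: cheb_phi_poly poly_at_X_const)

lemma cheb_phi_x: "cheb_phi (weyl_poly [:0, 1:]) = lf_of chebX"
  by (simp add: cheb_phi_poly poly_at_X_pCons)

lemma cheb_phi_D: "cheb_phi weyl_D = chebD"
  by (simp add: cheb_phi_def weyl_D_def poly_at_X_pCons)

definition right_dvd :: "'a::times \<Rightarrow> 'a \<Rightarrow> bool" where
  "right_dvd a m \<longleftrightarrow> (\<exists>q. m = q * a)"

text \<open>Least common left multiples and greatest common left divisors are determined only up to
  units, so they are relations, and so are the reduction rules built on them.\<close>

definition is_lclm :: "'a::times \<Rightarrow> 'a \<Rightarrow> 'a \<Rightarrow> bool" where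
  "is_lclm m a b \<longleftrightarrow> right_dvd a m \<and> right_dvd b m \<and>
     (\<forall>c. right_dvd a c \<and> right_dvd b c \<longrightarrow> right_dvd m c)"

definition left_dvd :: "'a::times \<Rightarrow> 'a \<Rightarrow> bool" where
  "left_dvd d a \<longleftrightarrow> (\<exists>q. a = d * q)"

definition is_gcld :: "'a::times \<Rightarrow> 'a \<Rightarrow> 'a \<Rightarrow> bool" where
  "is_gcld d a b \<longleftrightarrow> left_dvd d a \<and> left_dvd d b \<and>
     (\<forall>c. left_dvd c a \<and> left_dvd c b \<longrightarrow> left_dvd c d)"

definition irreducible_frac :: "'a::monoid_mult \<Rightarrow> 'a \<Rightarrow> bool" where
  "irreducible_frac Q P \<longleftrightarrow> is_gcld 1 P Q"

text \<open>Pairs are (denominator, numerator) and are not identified when they represent the same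
  fraction.\<close>

definition frac_sum :: "'a::ring_1 \<times> 'a \<Rightarrow> 'a \<times> 'a \<Rightarrow> 'a \<times> 'a \<Rightarrow> bool" where
  "frac_sum = (\<lambda>(Q1, P1) (Q2, P2) (Q, P).
     \<exists>T1 T2. is_lclm Q Q1 Q2 \<and> T1 * Q1 = Q \<and> T2 * Q2 = Q \<and> P = T1 * P1 + T2 * P2)"

definition frac_prod :: "'a::ring_1 \<times> 'a \<Rightarrow> 'a \<times> 'a \<Rightarrow> 'a \<times> 'a \<Rightarrow> bool" where
  "frac_prod = (\<lambda>(Q1, P1) (Q2, P2) (Q, P).
     \<exists>m P' Q'. is_lclm m Q2 P1 \<and> P' * P1 = m \<and> Q' * Q2 = m \<and> Q = P' * Q1 \<and> P = Q' * P2)"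

text \<open>\<open>horner p k i f\<close>: some run of the evaluation, started from \<open>p\<^sub>k(X)\<close>, has the fraction \<open>f\<close>
  after \<open>p\<^sub>i(X)\<close> has been added; every choice of least common left multiples is admitted.\<close>

inductive horner :: "(nat \<Rightarrow> rat poly) \<Rightarrow> nat \<Rightarrow> nat \<Rightarrow> skew_laurent \<times> skew_laurent \<Rightarrow> bool"
  for p k where
  horner_start: "horner p k k (1, poly_at_X (p k))"
| horner_step: "horner p k (Suc i) f \<Longrightarrow> frac_prod f (chebDden, chebDnum) g
    \<Longrightarrow> frac_sum g (1, poly_at_X (p i)) h \<Longrightarrow> horner p k i h"

text \<open>The usual form of one step, in which \<open>lclm(Q, 1)\<close> is taken to be \<open>Q\<close>.\<close>

lemma horner_explicit_step:
  assumes "horner p k (Suc i) (Q, P)" "is_lclm m chebDden P" "P' * P = m" "U * chebDden = m"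
  shows "horner p k i (P' * Q, U * chebDnum + P' * Q * poly_at_X (p i))"
proof (rule horner_step[OF assms(1)])
  show "frac_prod (Q, P) (chebDden, chebDnum) (P' * Q, U * chebDnum)"
    using assms by (auto simp: frac_prod_def)
  show "frac_sum (P' * Q, U * chebDnum) (1, poly_at_X (p i))
      (P' * Q, U * chebDnum + P' * Q * poly_at_X (p i))"
    unfolding frac_sum_def is_lclm_def right_dvd_def prod.case
    by (rule exI[of _ 1], rule exI[of _ "P' * Q"]) (auto intro: exI[of _ 1])
qed

end

theory Submission
  imports Defs
begin

text \<open>Call \<open>Q\<^sup>-\<^sup>1 P\<close> reduced if \<open>Q\<close> generates the left ideal of all \<open>a\<close> with \<open>a Q\<^sup>-\<^sup>1 P\<close> in the Laurent
  ring; a reduced fraction is irreducible. Every intermediate fraction \<open>f = Q\<^sup>-\<^sup>1 P\<close> of Horner's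
  rule is reduced. Adding a polynomial does not change the denominator ideal. As \<open>2n\<close> is a unit,
  \<open>a f D\<close> is in the ring iff \<open>a f\<close> is a left multiple of \<open>\<Delta> = S\<^sup>-\<^sup>1 - S\<close>; then \<open>a f\<close> is in
  the ring, so \<open>a = e Q\<close> and \<open>e P\<close> is a common left multiple of \<open>P\<close> and \<open>\<Delta>\<close>, hence \<open>e\<close> is
  a left multiple of the cofactor \<open>P'\<close> in \<open>lclm(\<Delta>, P) = P' P\<close>. This needs \<open>P \<noteq> 0\<close>, that is,
  injectivity of the morphism: commuting with \<open>X\<close> acts as differentiation with respect to \<open>D\<close>, so
  a polynomial in \<open>D\<close> that vanishes has vanishing leading coefficient.\<close>

section \<open>Reduced fractions under the two reduction rules\<close>

lemma lf_of_denom_mult_Lfrac: "Q \<noteq> 0 \<Longrightarrow> lf_of Q * Lfrac Q P = lf_of P"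
proof -
  assume "Q \<noteq> 0"
  moreover from this have "lf_of Q \<noteq> 0" using lf_of_eq_iff[of Q 0] by simp
  ultimately show ?thesis by (simp add: Lfrac_conv_inverse flip: mult.assoc)
qed

definition reduced_frac :: "'a::left_ore_domain \<Rightarrow> 'a \<Rightarrow> bool" where
  "reduced_frac Q P \<longleftrightarrow> (\<forall>a r. lf_of a * Lfrac Q P = lf_of r \<longrightarrow> right_dvd Q a)"

lemma reduced_frac_denom_1: "reduced_frac 1 P"
  by (auto simp: reduced_frac_def right_dvd_def)

text \<open>Cancelling a common left divisor \<open>c\<close> from \<open>Q = c * q\<close> leaves a
  fraction with denominator \<open>q\<close>; reducedness gives
  \<open>q = e * Q = e * c * q\<close>, so \<open>c\<close> is a unit.\<close>

lemma irreducible_frac_if_reduced: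
  assumes "reduced_frac Q P" and Q: "Q \<noteq> 0"
  shows "irreducible_frac Q P"
proof -
  have "left_dvd c 1" if c: "left_dvd c P" "left_dvd c Q" for c
  proof -
    obtain p q where pq: "P = c * p" "Q = c * q" using c by (auto simp: left_dvd_def)
    with Q have nz: "c \<noteq> 0" "q \<noteq> 0" by auto
    have "lf_of q * Lfrac Q P = lf_of p"
      using nz by (simp add: pq Lfrac_expand lf_of_denom_mult_Lfrac)
    then obtain e where "q = e * Q" using assms by (auto simp: reduced_frac_def right_dvd_def)
    hence "(e * c) * q = 1 * q" by (simp add: pq mult.assoc)
    hence "e * c = 1" using nz by (metis mult_right_cancel)
    hence "(c * e) * c = 1 * c" by (simp add: mult.assoc)
    hence "c * e = 1" using nz by (metis mult_right_cancel)
    thus ?thesis by (metis left_dvd_def)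
  qed
  thus ?thesis by (auto simp: irreducible_frac_def is_gcld_def left_dvd_def)
qed

text \<open>\<open>lclm(Q1, 1)\<close> is \<open>Q1\<close> up to a left unit, and adding
  \<open>p\<close> changes \<open>a f\<close> only by the ring element \<open>a * p\<close>.\<close>

lemma reduced_frac_sum:
  assumes red: "reduced_frac Q1 P1" and Q1: "Q1 \<noteq> 0" and sum: "frac_sum (Q1, P1) (1, p) (Q, P)"
  shows "Q \<noteq> 0" "Lfrac Q P = Lfrac Q1 P1 + lf_of p" "reduced_frac Q P"
proof -
  obtain T1 T2 where T: "is_lclm Q Q1 1" "T1 * Q1 = Q" "T2 * 1 = Q" "P = T1 * P1 + T2 * p"
    using sum by (auto simp: frac_sum_def)
  have "right_dvd Q Q1" using T(1) by (auto simp: is_lclm_def right_dvd_def intro: exI[of _ 1])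
  then obtain w where w: "Q1 = w * Q" by (auto simp: right_dvd_def)
  show Q: "Q \<noteq> 0" using w Q1 by auto
  have "Lfrac Q (T1 * P1) = Lfrac Q1 P1" using Q T(2) Q1 Lfrac_expand[of T1 Q1 P1] by auto
  moreover have "Lfrac Q (T2 * p) = lf_of p"
    using Q T(3) Lfrac_expand[of T2 1 p] by (simp add: lf_of_def)
  ultimately show eq: "Lfrac Q P = Lfrac Q1 P1 + lf_of p"
    using plus_Lfrac[OF Q, of "T1 * P1" "T2 * p"] T(4) by simp
  show "reduced_frac Q P"
    unfolding reduced_frac_def
  proof (intro allI impI)
    fix a r assume "lf_of a * Lfrac Q P = lf_of r"
    moreover have "lf_of (r - a * p) + lf_of (a * p) = lf_of r" by (simp flip: lf_of_add)
    ultimately have "lf_of a * Lfrac Q1 P1 + lf_of (a * p) = lf_of (r - a * p) + lf_of (a * p)"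
      by (simp add: eq distrib_left lf_of_mult)
    hence "lf_of a * Lfrac Q1 P1 = lf_of (r - a * p)" by simp
    then obtain e where "a = e * Q1" using red by (auto simp: reduced_frac_def right_dvd_def)
    thus "right_dvd Q a" using w by (auto simp: right_dvd_def simp flip: mult.assoc)
  qed
qed

lemma reduced_frac_prod:
  assumes red: "reduced_frac Q1 P1" and nz: "Q1 \<noteq> 0" "P1 \<noteq> 0" "d \<noteq> 0" and unit: "c * c' = 1"
    and prod: "frac_prod (Q1, P1) (d, c) (Q, P)"
  shows "Q \<noteq> 0" "Lfrac Q P = Lfrac Q1 P1 * Lfrac d c" "reduced_frac Q P"
proof -
  obtain m P' U where m: "is_lclm m d P1" "P' * P1 = m" "U * d = m" "Q = P' * Q1" "P = U * c"
    using prod by (auto simp: frac_prod_def)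
  \<comment> \<open>The Ore condition gives a nonzero common left multiple; \<open>m\<close>
    right-divides it, hence \<open>m \<noteq> 0\<close>.\<close>
  obtain u v where uv: "u \<noteq> 0" "u * d = v * P1" using left_ore2[OF nz(3,2)] by metis
  have "right_dvd m (u * d)" using m(1) uv unfolding is_lclm_def right_dvd_def by blast
  hence "m \<noteq> 0" using uv(1) nz(3) by (auto simp: right_dvd_def)
  hence P': "P' \<noteq> 0" using m(2) by auto
  show "Q \<noteq> 0" using P' nz m(4) by simp
  show eq: "Lfrac Q P = Lfrac Q1 P1 * Lfrac d c"
    using times_Lfrac_Lfrac[OF nz(1,3) P', of P1 U c] m by simp
  have d: "lf_of d \<noteq> 0" using nz(3) lf_of_eq_iff[of d 0] by simp
  show "reduced_frac Q P"
    unfolding reduced_frac_def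
  proof (intro allI impI)
    fix a r assume a: "lf_of a * Lfrac Q P = lf_of r"
    \<comment> \<open>Since \<open>c * c' = 1\<close>, right multiplication by \<open>c' * d\<close>
      undoes the new factor and exhibits \<open>a f\<close> as a left multiple of
      \<open>d\<close>.\<close>
    have "Lfrac d c * lf_of (c' * d) = inverse (lf_of d) * lf_of (c * c' * d)"
      by (simp add: Lfrac_conv_inverse[OF nz(3)] mult.assoc flip: lf_of_mult)
    also have "\<dots> = 1" using d by (simp add: unit)
    finally have "Lfrac d c * lf_of (c' * d) = 1" .
    hence r: "lf_of a * Lfrac Q1 P1 = lf_of (r * c' * d)"
      using arg_cong[OF a, of "\<lambda>x. x * lf_of (c' * d)"]
      by (simp only: eq mult.assoc lf_of_mult[of r]) simp
    then obtain e where e: "a = e * Q1" using red by (auto simp: reduced_frac_def right_dvd_def)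
    have "lf_of (e * P1) = lf_of (r * c' * d)"
      using r by (simp add: e lf_of_mult mult.assoc lf_of_denom_mult_Lfrac[OF nz(1)])
    hence "e * P1 = r * c' * d" by simp
    hence "right_dvd m (e * P1)" using m(1) unfolding is_lclm_def right_dvd_def by blast
    then obtain w where "e * P1 = w * m" by (auto simp: right_dvd_def)
    hence "e * P1 = (w * P') * P1" by (simp flip: m(2) add: mult.assoc)
    hence "e = w * P'" using nz(2) by simp
    thus "right_dvd Q a" by (auto simp: e m(4) right_dvd_def mult.assoc)
  qed
qed

section \<open>Existence of least common left multiples\<close>

text \<open>A nonzero common left multiple of minimal width works: the remainder of any other one
  modulo it is again a common left multiple, of smaller width, hence 0.\<close>

lemma skew_laurent_lclm_ex:
  fixes a b :: skew_laurent
  assumes "a \<noteq> 0" "b \<noteq> 0"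
  shows "\<exists>m. is_lclm m a b"
proof -
  define C where "C c \<longleftrightarrow> c \<noteq> 0 \<and> right_dvd a c \<and> right_dvd b c" for c
  obtain u v where "u \<noteq> 0" "u * a = v * b" using left_ore2[OF assms] by metis
  hence "C (u * a)" using assms unfolding C_def right_dvd_def by (metis mult_eq_0_iff)
  then obtain m where m: "C m" and min: "\<And>c. C c \<Longrightarrow> sl_width m \<le> sl_width c"
    using ex_has_least_nat[of C _ sl_width] by blast
  have "right_dvd m c" if "right_dvd a c" "right_dvd b c" for c
  proof -
    obtain q where q: "sl_width (c - q * m) < sl_width m"
      using skew_laurent_division m by (auto simp: C_def)
    have "right_dvd x (c - q * m)" if "right_dvd x c" "right_dvd x m" for x
      using that by (auto simp: right_dvd_def mult.assoc[symmetric] left_diff_distrib[symmetric])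
    with that m have "right_dvd a (c - q * m)" "right_dvd b (c - q * m)" by (auto simp: C_def)
    hence "c - q * m = 0" using min[of "c - q * m"] q by (auto simp: C_def)
    thus ?thesis by (auto simp: right_dvd_def)
  qed
  thus ?thesis using m by (auto simp: C_def is_lclm_def)
qed

section \<open>Injectivity of the morphism\<close>

text \<open>Multiplication by X extends the support by one at both ends, so for nonzero
  \<open>q\<close> the product has at least two exponents and cannot cancel against a constant. This
  makes X transcendental over the rationals.\<close>

lemma sconst_plus_chebX_mult_eq_0:
  assumes "sconst c + chebX * q = 0"
  shows "c = 0 \<and> q = 0"
proof -
  have X: "scoeff (chebX * q) i = 1 / 2 * shift 1 (scoeff q (i - 1)) + 1 / 2 * shift (- 1) (scoeff q (i + 1))"
    for i
    by (simp add: chebX_eq distrib_right scoeff_plus scoeff_smonom_times)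
  have 0: "scoeff (chebX * q) i = 0" if "i \<noteq> 0" for i
    using arg_cong[OF assms, of "\<lambda>f. scoeff f i"] that by (simp add: scoeff_simps sconst_def)
  have "q = 0"
  proof (rule ccontr)
    assume q: "q \<noteq> 0"
    \<comment> \<open>So at \<open>top_exp q + 1\<close> only the S term of X contributes, and at
      \<open>bot_exp q - 1\<close> only the S^-1 term.\<close>
    have "scoeff q (top_exp q + 2) = 0" "scoeff q (bot_exp q - 2) = 0"
      using le_top_exp[of q "top_exp q + 2"] bot_exp_le[of q "bot_exp q - 2"] by force+
    hence "scoeff (chebX * q) (top_exp q + 1) \<noteq> 0" "scoeff (chebX * q) (bot_exp q - 1) \<noteq> 0"
      using scoeff_top_exp[OF q] scoeff_bot_exp[OF q] by (simp_all add: X algebra_simps)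
    hence "top_exp q + 1 = 0" "bot_exp q - 1 = 0" using 0 by blast+
    thus False using bot_exp_le[OF scoeff_top_exp[OF q]] by simp
  qed
  moreover from this have "scoeff (sconst c) 0 = scoeff 0 0" using assms by simp
  ultimately show ?thesis by (simp add: sconst_def scoeff_simps)
qed

lemma poly_at_X_eq_0_iff: "poly_at_X p = 0 \<longleftrightarrow> p = 0"
proof
  show "poly_at_X p = 0 \<Longrightarrow> p = 0"
  proof (induction p)
    case (pCons c p)
    have "to_fract [:c:] = 0 \<and> poly_at_X p = 0"
      using pCons.prems by (intro sconst_plus_chebX_mult_eq_0) (simp add: poly_at_X_pCons)
    thus ?case using pCons.IH by simp
  qed simp
qed simp

lemma poly_at_X_chebX_commute: "poly_at_X p * chebX = chebX * poly_at_X p"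
  using poly_at_X_mult[of p "[:0, 1:]"] poly_at_X_mult[of "[:0, 1:]" p]
  by (simp add: poly_at_X_pCons mult.commute)

lemma chebD_pow_Suc_chebX:
  "chebD ^ Suc j * lf_of chebX = lf_of chebX * chebD ^ Suc j + of_nat (Suc j) * chebD ^ j"
proof (induction j)
  case (Suc j)
  have "chebD ^ Suc (Suc j) * lf_of chebX = chebD * (chebD ^ Suc j * lf_of chebX)"
    by (simp add: mult.assoc)
  also have "\<dots> = (chebD * lf_of chebX) * chebD ^ Suc j + of_nat (Suc j) * (chebD * chebD ^ j)"
    by (simp only: Suc distrib_left) (metis mult.assoc mult_of_nat_commute)
  also have "\<dots> = lf_of chebX * chebD ^ Suc (Suc j) + of_nat (Suc (Suc j)) * chebD ^ Suc j"
    by (simp add: chebD_chebX algebra_simps)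
  finally show ?case .
qed (simp add: chebD_chebX)

lemma poly_at_X_of_nat: "lf_of (poly_at_X (of_nat n)) = of_nat n"
  by (induction n) (simp_all add: poly_at_X_add lf_of_add)

text \<open>If E = 0, then E X - X E = 0 as well; this is the formal derivative of E in D, of degree
  one less and with leading coefficient a nonzero integer times that of E.\<close>

lemma chebD_poly_eq_0_imp:
  assumes "(\<Sum>j\<le>n. lf_of (poly_at_X (q j)) * chebD ^ j) = 0"
  shows "q n = 0"
  using assms
proof (induction n arbitrary: q)
  case 0
  thus ?case using lf_of_eq_iff[of "poly_at_X (q 0)" 0] by (simp add: poly_at_X_eq_0_iff)
next
  case (Suc n)
  let ?X = "lf_of chebX" and ?f = "\<lambda>p. lf_of (poly_at_X p)"
  let ?E = "\<Sum>j\<le>Suc n. ?f (q j) * chebD ^ j"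
  let ?q' = "\<lambda>j. of_nat (Suc j) * q (Suc j)"
  have comm: "?f p * ?X = ?X * ?f p" for p
    by (simp add: poly_at_X_chebX_commute flip: lf_of_mult)
  have D_X: "?f (q (Suc j)) * chebD ^ Suc j * ?X
      = ?X * (?f (q (Suc j)) * chebD ^ Suc j) + ?f (?q' j) * chebD ^ j" for j
  proof -
    have "?f (?q' j) = ?f (q (Suc j)) * of_nat (Suc j)"
      by (simp only: mult.commute[of "of_nat (Suc j)"] poly_at_X_mult lf_of_mult poly_at_X_of_nat)
    moreover have "?f (q (Suc j)) * (?X * chebD ^ Suc j) = ?X * (?f (q (Suc j)) * chebD ^ Suc j)"
      by (simp only: mult.assoc[symmetric] comm)
    ultimately show ?thesis
      by (simp only: mult.assoc chebD_pow_Suc_chebX distrib_left)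
  qed
  \<comment> \<open>Splitting off the term \<open>j = 0\<close>, which commutes with X, aligns the
    indices of the derivative.\<close>
  have "?E * ?X = ?X * ?E + (\<Sum>j\<le>n. ?f (?q' j) * chebD ^ j)"
    by (subst (1 2) sum.atMost_Suc_shift)
      (simp only: distrib_right distrib_left sum_distrib_right sum_distrib_left D_X sum.distrib
        power_0 mult_1_right comm add.assoc)
  with Suc.prems have "(\<Sum>j\<le>n. ?f (?q' j) * chebD ^ j) = 0" by simp
  from Suc.IH[OF this] have "of_nat (Suc n) * q (Suc n) = 0" .
  moreover have "(of_nat (Suc n) :: rat poly) \<noteq> 0" by (simp only: of_nat_eq_0_iff)
  ultimately show ?case by simp
qed

section \<open>Horner's rule and its invariant\<close>

lemma chebDnum_unit: "\<exists>c. chebDnum * c = 1"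
proof
  have "2 * rat_n \<noteq> 0" by (simp add: rat_n_def)
  note right_inverse[OF this]
  thus "chebDnum * sconst (inverse (2 * rat_n)) = 1"
    unfolding chebDnum_def by (simp only: sconst_mult[symmetric] sconst_1)
qed

text \<open>The exact value in the skew field once \<open>p i\<close> has been added, independent of
  the choices of lclm.\<close>

definition horner_value :: "(nat \<Rightarrow> rat poly) \<Rightarrow> nat \<Rightarrow> nat \<Rightarrow> skew_laurent lfrac" where
  "horner_value p k i = (\<Sum>j\<in>{i..k}. lf_of (poly_at_X (p j)) * chebD ^ (j - i))"

lemma horner_value_Suc:
  assumes "Suc i \<le> k"
  shows "horner_value p k i = horner_value p k (Suc i) * chebD + lf_of (poly_at_X (p i))"
proof -
  have "chebD ^ (j - i) = chebD ^ (j - Suc i) * chebD" if "j \<in> {Suc i..k}" for j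
    using that by (simp add: Suc_diff_Suc flip: power_Suc2)
  hence "(\<Sum>j\<in>{Suc i..k}. lf_of (poly_at_X (p j)) * chebD ^ (j - i)) = horner_value p k (Suc i) * chebD"
    unfolding horner_value_def sum_distrib_right by (intro sum.cong) (simp_all add: mult.assoc)
  moreover have "{i..k} = insert i {Suc i..k}" using assms by auto
  ultimately show ?thesis by (simp add: horner_value_def)
qed

lemma horner_value_nz:
  assumes "i \<le> k" "p k \<noteq> 0"
  shows "horner_value p k i \<noteq> 0"
proof
  assume "horner_value p k i = 0"
  moreover have "horner_value p k i = (\<Sum>j\<le>k - i. lf_of (poly_at_X (p (i + j))) * chebD ^ j)"
    unfolding horner_value_def
    by (rule sum.reindex_bij_witness[of _ "\<lambda>j. i + j" "\<lambda>j. j - i"]) (use assms in auto)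
  ultimately show False using chebD_poly_eq_0_imp[of "\<lambda>j. p (i + j)" "k - i"] assms by simp
qed

text \<open>The value is tracked together with reducedness because it yields the nonzero numerator
  that the product rule needs.\<close>

lemma horner_invariant:
  assumes "horner p k i f" "p k \<noteq> 0"
  shows "i \<le> k \<and> fst f \<noteq> 0 \<and> Lfrac (fst f) (snd f) = horner_value p k i
    \<and> reduced_frac (fst f) (snd f)"
  using assms(1)
proof induction
  case horner_start
  show ?case by (simp add: horner_value_def lf_of_def[symmetric] reduced_frac_denom_1)
next
  case (horner_step i f g h)
  obtain Q1 P1 Q2 P2 Q P where fgh: "f = (Q1, P1)" "g = (Q2, P2)" "h = (Q, P)" by (metis surj_pair)
  from horner_step.IH have f: "Suc i \<le> k" "Q1 \<noteq> 0" "Lfrac Q1 P1 = horner_value p k (Suc i)"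
    "reduced_frac Q1 P1" by (simp_all add: fgh)
  have P1: "P1 \<noteq> 0" using horner_value_nz[of "Suc i" k p] f assms(2) Lfrac_zero[of Q1] by auto
  obtain c where c: "chebDnum * c = 1" using chebDnum_unit by blast
  note g = reduced_frac_prod[OF f(4,2) P1 chebDden_nz c horner_step.hyps(2)[unfolded fgh]]
  note h = reduced_frac_sum[OF g(3,1) horner_step.hyps(3)[unfolded fgh]]
  show ?case
    using f h g(2) by (simp add: fgh horner_value_Suc chebD_def)
qed

text \<open>No run gets stuck: the numerator is never 0, so the next lclm exists. The statement
  about all runs is therefore not vacuous.\<close>

lemma horner_ex:
  assumes "p k \<noteq> 0" "i \<le> k"
  shows "\<exists>Q P. horner p k i (Q, P)"
  using assms(2)
proof (induction i rule: inc_induct)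
  case base
  show ?case by (blast intro: horner_start)
next
  case (step i)
  then obtain Q P where QP: "horner p k (Suc i) (Q, P)" by blast
  have "P \<noteq> 0"
    using horner_invariant[OF QP assms(1)] horner_value_nz[of "Suc i" k p] assms(1) Lfrac_zero[of Q]
    by auto
  then obtain m where m: "is_lclm m chebDden P" using skew_laurent_lclm_ex chebDden_nz by blast
  then obtain P' U where "P' * P = m" "U * chebDden = m"
    unfolding is_lclm_def right_dvd_def by metis
  from horner_explicit_step[OF QP m this] show ?case by blast
qed

lemma cheb_phi_power: "cheb_phi (L ^ i) = cheb_phi L ^ i"
  by (induction i) (simp_all add: cheb_phi_mult)

lemma cheb_phi_sum: "cheb_phi (sum f A) = (\<Sum>i\<in>A. cheb_phi (f i))"
  by (induction A rule: infinite_finite_induct) (simp_all add: cheb_phi_add)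

theorem proposition2:
  fixes L :: weyl and p :: "nat \<Rightarrow> rat poly" and k :: nat
  assumes "L = (\<Sum>i\<le>k. weyl_poly (p i) * weyl_D ^ i)"
    and "p k \<noteq> 0"
  shows "(\<exists>Q P. horner p k 0 (Q, P)) \<and>
    (\<forall>Q P. horner p k 0 (Q, P) \<longrightarrow>
       Q \<noteq> 0 \<and> cheb_phi L = Lfrac Q P \<and> irreducible_frac Q P)"
proof -
  have "cheb_phi L = horner_value p k 0"
    by (simp add: assms(1) cheb_phi_sum cheb_phi_mult cheb_phi_power cheb_phi_poly cheb_phi_D
        horner_value_def atMost_atLeast0)
  thus ?thesis
    using horner_ex[of p k 0] horner_invariant[of p k 0] assms(2) irreducible_frac_if_reduced
    by fastforce
qed

end
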